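(* Let $1<q\le\infty$. Let $\Omega$ be an ellipsoid $\Omega=\{z\in\mathbb C^n: \sum_{j=1}^n|z_j|^2/a_j^2<1\}$ with $a_1,\dots,a_n>0$ (in particular the unit ball of $\mathbb C^n$). Then the set $$\Big\{g\in\bigcap_{p<q}\mathcal{O}L^p(\Omega): g\text{ totally unbounded in }\Omega,\ g\notin\mathcal{O}L^q(B(\zeta,\varepsilon)\cap\Omega)\ \forall\zeta\in\partial\Omega,\ \forall\varepsilon>0\Big\}$$ is dense and $G_\delta$ in $\bigcap_{p<q}\mathcal{O}L^p(\Omega)$.
   Context: For an open bounded set $D$ and $p\ge1$, $\mathcal{O}L^p(D)$ is the space of holomorphic $f$ on $D$ with $\int_D|f|^p\,dv<\infty$; $\mathcal{O}L^\infty(D)$ is the space of bounded holomorphic functions. For $1<q\le\infty$, $\bigcap_{p<q}\mathcal{O}L^p(\Omega)$ carries the complete metric $d(f,g)=\sum_j2^{-j}\frac{\|f-g\|_{p_j}}{1+\|f-g\|_{p_j}}$ with $1<p_1<p_2<\dots$, $p_j\to q$; convergence means $\|f_k-f\|_p\to0$ for all $p<q$. A holomorphic $f$ is totally unbounded in $\Omega$ if for every $w\in\partial\Omega$, $\delta>0$ and every connected component $E$ of $B(w,\delta)\cap\Omega$, $\sup_E|f|=\infty$. *)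

theory Defs
  imports "HOL-Analysis.Analysis"
begin

definition holo_on :: "(complex ^ 'n \<Rightarrow> complex) \<Rightarrow> (complex ^ 'n) set \<Rightarrow> bool" where
  "holo_on f D \<longleftrightarrow> (\<forall>z\<in>D. \<exists>L. (f has_derivative L) (at z) \<and> (\<forall>c v. L (c *s v) = c * L v))"

definition OL :: "ereal \<Rightarrow> (complex ^ 'n) set \<Rightarrow> (complex ^ 'n \<Rightarrow> complex) set" where
  "OL p D = {f. holo_on f D \<and>
     (if p = \<infinity> then bounded (f ` D)
      else (\<integral>\<^sup>+ z. indicator D z * ennreal (norm (f z) powr real_of_ereal p) \<partial>lborel) < \<infinity>)}"

definition Lpnorm :: "real \<Rightarrow> (complex ^ 'n) set \<Rightarrow> (complex ^ 'n \<Rightarrow> complex) \<Rightarrow> real" where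
  "Lpnorm p D f = enn2real (\<integral>\<^sup>+ z. indicator D z * ennreal (norm (f z) powr p) \<partial>lborel) powr (1 / p)"

text \<open>The space \<Inter>_{p<q} OL^p(\<Omega>); functions are normalised to vanish outside \<Omega>.\<close>
definition OLbelow :: "ereal \<Rightarrow> (complex ^ 'n) set \<Rightarrow> (complex ^ 'n \<Rightarrow> complex) set" where
  "OLbelow q D = {f. (\<forall>p::real. 1 \<le> p \<and> ereal p < q \<longrightarrow> f \<in> OL (ereal p) D) \<and> (\<forall>z. z \<notin> D \<longrightarrow> f z = 0)}"

text \<open>The metric d(f,g) = \<Sum>_j 2^{-j} ||f-g||_{p_j} / (1 + ||f-g||_{p_j}) (indices shifted to start at 0).\<close>
definition OLdist :: "(nat \<Rightarrow> real) \<Rightarrow> (complex ^ 'n) set \<Rightarrow>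
    (complex ^ 'n \<Rightarrow> complex) \<Rightarrow> (complex ^ 'n \<Rightarrow> complex) \<Rightarrow> real" where
  "OLdist ps D f g = (\<Sum>j. (1/2) ^ (Suc j) *
      (Lpnorm (ps j) D (\<lambda>z. f z - g z) / (1 + Lpnorm (ps j) D (\<lambda>z. f z - g z))))"

definition totally_unbounded :: "(complex ^ 'n \<Rightarrow> complex) \<Rightarrow> (complex ^ 'n) set \<Rightarrow> bool" where
  "totally_unbounded f D \<longleftrightarrow>
     (\<forall>w\<in>frontier D. \<forall>\<delta>>0. \<forall>E\<in>components (ball w \<delta> \<inter> D).
        (SUP z\<in>E. ereal (norm (f z))) = \<infinity>)"

definition ellipsoid :: "('n::finite \<Rightarrow> real) \<Rightarrow> (complex ^ 'n) set" where
  "ellipsoid a = {z. (\<Sum>j\<in>UNIV. (cmod (z $ j))\<^sup>2 / (a j)\<^sup>2) < 1}"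

end

theory Submission
  imports Defs
begin

text \<open>
  Since the ellipsoid is convex, each \<open>ball w \<delta> \<inter> \<Omega>\<close> is connected, and total unboundedness follows from
  the failure of local \<open>L\<^sup>q\<close>-integrability at the boundary. By density of a sequence \<open>\<zeta>\<^sub>i\<close> in the
  boundary it suffices to consider countably many sets \<open>U\<close>. For such a \<open>U\<close>, a function of the space is
  in \<open>OL q U\<close> iff its norms in \<open>L\<^bsup>p\<^sub>j\<^esup>(U)\<close> are bounded in \<open>j\<close>, which yields the \<open>G\<^sub>\<delta>\<close> property. Density
  needs a single \<open>g\<close> outside all \<open>OL q U\<close>: on a line \<open>f + t g\<close> each \<open>U\<close> excludes at most one \<open>t\<close>.

  To construct \<open>g\<close>, let \<open>\<langle>z, w\<rangle>\<close> be the Hermitian form whose unit ball is \<open>\<Omega>\<close> and put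
  \<open>G z = (\<Sum>i. 2\<^bsup>-i-1\<^esup> \<cdot> 2 / (1 - \<langle>z, \<zeta>\<^sub>i\<rangle>))\<close>. All summands have real part at least 1, so they cannot cancel.
  The kernel \<open>1 / (1 - \<langle>z, \<zeta>\<rangle>)\<close> is in \<open>L\<^sup>r\<close> exactly for \<open>r < n + 1\<close>, hence \<open>g = G powr ((n + 1) / q)\<close> for
  finite \<open>q\<close>, and \<open>g = Ln G\<close> for \<open>q = \<infinity>\<close>, have the required integrability.
\<close>

subsection \<open>Holomorphic functions and Lebesgue norms\<close>

text \<open>One function has to fail at every boundary point at once and still lie in all
  \<open>L^p\<close> with \<open>p < q\<close>. Kernels with poles at a dense set of boundary points
  can be superposed only if their norms are bounded independently of the point. Therefore the volume
  of a cap is estimated at one point on a coordinate axis, and linear maps preserving the Hermitian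
  form and Lebesgue measure carry the estimate to all boundary points with the same constant. The
  exponent \<open>n + 1\<close> is the balance between kernel size \<open>1 / t\<close> and cap
  volume \<open>t^(n + 1)\<close>. The power \<open>(n + 1) / q\<close> moves this threshold to
  \<open>q\<close>; the logarithm replaces it for infinite \<open>q\<close>, since it is unbounded
  but grows more slowly than every positive power. The half plane \<open>Re w >= 1\<close>, in which
  \<open>G\<close> takes its values, also provides holomorphic branches of both. The metric sees
  only exponents below \<open>q\<close>, while the property in question lives at \<open>q\<close>.
  Fatou's lemma for finite \<open>q\<close>, and Chebyshev's inequality with growing exponents for
  infinite \<open>q\<close>, connect the two.\<close>

abbreviation Lpint :: "real \<Rightarrow> (complex ^ 'n) set \<Rightarrow> (complex ^ 'n \<Rightarrow> complex) \<Rightarrow> ennreal" where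
  "Lpint p D f \<equiv> \<integral>\<^sup>+ z. indicator D z * ennreal (norm (f z) powr p) \<partial>lborel"

lemma holo_on_imp_continuous_on: "holo_on f D \<Longrightarrow> continuous_on D f"
  unfolding holo_on_def
  by (meson continuous_at_imp_continuous_on has_derivative_continuous)

lemma holo_on_subset: "holo_on f D \<Longrightarrow> E \<subseteq> D \<Longrightarrow> holo_on f E"
  unfolding holo_on_def by blast

lemma holo_on_add:
  assumes "holo_on f D" "holo_on g D"
  shows "holo_on (\<lambda>z. f z + g z) D"
  unfolding holo_on_def
proof
  fix z assume "z \<in> D"
  then obtain L M where L: "(f has_derivative L) (at z)" "\<forall>c v. L (c *s v) = c * L v"
    and M: "(g has_derivative M) (at z)" "\<forall>c v. M (c *s v) = c * M v"
    using assms unfolding holo_on_def by meson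
  show "\<exists>L. ((\<lambda>z. f z + g z) has_derivative L) (at z) \<and> (\<forall>c v. L (c *s v) = c * L v)"
    using has_derivative_add[OF L(1) M(1)] L(2) M(2)
    by (intro exI[of _ "\<lambda>v. L v + M v"]) (auto simp: algebra_simps)
qed

lemma holo_on_cmult:
  assumes "holo_on f D"
  shows "holo_on (\<lambda>z. k * f z) D"
  unfolding holo_on_def
proof
  fix z assume "z \<in> D"
  then obtain L where L: "(f has_derivative L) (at z)" "\<forall>c v. L (c *s v) = c * L v"
    using assms unfolding holo_on_def by meson
  show "\<exists>L. ((\<lambda>z. k * f z) has_derivative L) (at z) \<and> (\<forall>c v. L (c *s v) = c * L v)"
    using has_derivative_mult_right[OF L(1), of k] L(2)
    by (intro exI[of _ "\<lambda>v. k * L v"]) (auto simp: algebra_simps)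
qed

lemma holo_on_compose:
  assumes f: "holo_on f D" and \<phi>: "\<And>z. z \<in> D \<Longrightarrow> \<phi> field_differentiable (at (f z))"
  shows "holo_on (\<lambda>z. \<phi> (f z)) D"
  unfolding holo_on_def
proof
  fix z assume z: "z \<in> D"
  then obtain L where L: "(f has_derivative L) (at z)" "\<forall>c v. L (c *s v) = c * L v"
    using f unfolding holo_on_def by meson
  obtain d where "(\<phi> has_field_derivative d) (at (f z))" using \<phi>[OF z] by (auto simp: field_differentiable_def)
  then have "(\<phi> has_derivative (*) d) (at (f z))" by (simp add: has_field_derivative_def)
  from has_derivative_compose[OF L(1) this] L(2)
  show "\<exists>L. ((\<lambda>z. \<phi> (f z)) has_derivative L) (at z) \<and> (\<forall>c v. L (c *s v) = c * L v)"
    by (intro exI[of _ "\<lambda>v. d * L v"]) (auto simp: algebra_simps)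
qed

lemma holo_on_cong_open:
  assumes "holo_on f D" "open D" "\<And>z. z \<in> D \<Longrightarrow> f z = g z"
  shows "holo_on g D"
  unfolding holo_on_def
proof
  fix z assume z: "z \<in> D"
  then obtain L where L: "(f has_derivative L) (at z)" "\<forall>c v. L (c *s v) = c * L v"
    using assms unfolding holo_on_def by meson
  then show "\<exists>L. (g has_derivative L) (at z) \<and> (\<forall>c v. L (c *s v) = c * L v)"
    using has_derivative_transform_within_open[OF L(1) assms(2) z] assms(3) by blast
qed

section \<open>Integrals of p-th powers, Minkowski's inequality, comparison of exponents\<close>

lemma measurable_Lp_integrand [measurable]:
  fixes f :: "complex ^ 'n \<Rightarrow> complex"
  assumes "open D" "continuous_on D f"
  shows "(\<lambda>z. indicator D z * ennreal (norm (f z) powr p)) \<in> borel_measurable lborel"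
proof -
  \<comment> \<open>\<open>f\<close> is arbitrary outside \<open>D\<close>, so it is replaced by its
    extension by zero, which is Borel because \<open>f\<close> is continuous on the open set
    \<open>D\<close>.\<close>
  have [measurable]: "(\<lambda>z. indicator D z *\<^sub>R f z) \<in> borel_measurable borel"
    using assms by (intro borel_measurable_continuous_on_indicator) auto
  have [measurable]: "D \<in> sets borel" using assms by auto
  have "(\<lambda>z. indicator D z * ennreal (norm (f z) powr p)) =
        (\<lambda>z. indicator D z * ennreal (norm (indicator D z *\<^sub>R f z) powr p))"
    by (auto simp: indicator_def)
  also have "\<dots> \<in> borel_measurable lborel" by measurable
  finally show ?thesis .
qed

lemma Lpint_mono_set: "U \<subseteq> D \<Longrightarrow> Lpint p U f \<le> Lpint p D f"
  by (intro nn_integral_mono mult_right_mono) (auto simp: indicator_def)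

lemma Lpint_eq_Lpnorm:
  assumes "p > 0" "Lpint p D f < \<infinity>"
  shows "Lpint p D f = ennreal (Lpnorm p D f powr p)"
  using assms by (simp add: Lpnorm_def powr_powr)

lemma Lpnorm_nonneg [simp]: "0 \<le> Lpnorm p D f"
  by (simp add: Lpnorm_def)

lemma Lpnorm_le_iff:
  assumes "p > 0" "Lpint p D f < \<infinity>" "0 \<le> A"
  shows "Lpnorm p D f \<le> A \<longleftrightarrow> Lpint p D f \<le> ennreal (A powr p)"
proof -
  have "Lpnorm p D f \<le> A \<longleftrightarrow> Lpnorm p D f powr p \<le> A powr p"
    using assms by (meson Lpnorm_nonneg not_le powr_less_mono2 powr_mono2 less_imp_le)
  then show ?thesis using assms by (simp add: Lpint_eq_Lpnorm)
qed

lemma Lpnorm_leI: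
  assumes "p > 0" "0 \<le> A" "Lpint p D f \<le> ennreal (A powr p)"
  shows "Lpnorm p D f \<le> A"
  using assms Lpnorm_le_iff[of p D f A] le_less_trans[OF assms(3), of \<infinity>] by auto

lemma convex_on_powr_atLeast_0:
  assumes "p \<ge> 1"
  shows "convex_on {0..} (\<lambda>x::real. x powr p)"
proof (rule convex_onI)
  fix t x y :: real assume *: "0 < t" "t < 1" "x \<in> {0..}" "y \<in> {0..}"
  \<comment> \<open>When \<open>x\<close> or \<open>y\<close> is 0, convexity reduces to this
    inequality. The endpoint 0 matters because the functions may vanish.\<close>
  have le: "t powr p \<le> t" if "0 \<le> t" "t \<le> 1" for t :: real
    using that assms powr_mono'[of 1 p t] by simp
  consider "x = 0" | "y = 0" | "x > 0 \<and> y > 0" using * by fastforce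
  then show "((1 - t) *\<^sub>R x + t *\<^sub>R y) powr p \<le> (1 - t) * x powr p + t * y powr p"
  proof cases
    case 1 then show ?thesis using * le[of t] by (auto simp: powr_mult intro!: mult_right_mono)
  next
    case 2 then show ?thesis using * le[of "1-t"] by (auto simp: powr_mult intro!: mult_right_mono)
  next
    case 3 then show ?thesis using powr_convex[OF assms] *
      by (auto simp: convex_on_def dest!: conjunct2)
  qed
qed auto

text \<open>\<open>(x + y) / (A + B)\<close> is the convex combination of \<open>x / A\<close> and
  \<open>y / B\<close> with weights \<open>A / (A + B)\<close> and \<open>B / (A + B)\<close>. If
  \<open>A\<close> and \<open>B\<close> bound the norms of two functions, the bracket integrates to
  at most 1: this is Minkowski's inequality before integration.\<close>

lemma powr_add_le_weighted:
  fixes x y A B p :: real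
  assumes "p \<ge> 1" "0 \<le> x" "0 \<le> y" "0 < A" "0 < B"
  shows "(x + y) powr p \<le> (A + B) powr p * (A / (A + B) * (x / A) powr p + B / (A + B) * (y / B) powr p)"
proof -
  have w: "1 - B / (A+B) = A / (A+B)" using assms by (simp add: field_simps)
  have "(A / (A+B) * (x / A) + B / (A+B) * (y / B)) powr p
      \<le> A / (A+B) * (x / A) powr p + B / (A+B) * (y / B) powr p"
    using convex_onD[OF convex_on_powr_atLeast_0[OF assms(1)], of "B / (A+B)" "x / A" "y / B"] assms
    by (simp add: w)
  moreover have "A / (A+B) * (x / A) + B / (A+B) * (y / B) = (x + y) / (A + B)"
    using assms by (simp add: add_divide_distrib)
  ultimately have "((x + y) / (A + B)) powr p \<le> A / (A+B) * (x / A) powr p + B / (A+B) * (y / B) powr p"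
    by simp
  then have "(A + B) powr p * ((x + y) / (A + B)) powr p \<le>
     (A + B) powr p * (A / (A+B) * (x / A) powr p + B / (A+B) * (y / B) powr p)"
    by (rule mult_left_mono) simp
  then show ?thesis using assms by (simp add: powr_mult[symmetric])
qed

lemma Lpint_add_le_weighted:
  assumes D: "open D" "continuous_on D f" "continuous_on D g" and p: "p \<ge> 1"
    and AB: "0 < A" "0 < B"
  shows "Lpint p D (\<lambda>z. f z + g z) \<le> ennreal ((A + B) powr p) *
           (ennreal (A / (A + B) / A powr p) * Lpint p D f + ennreal (B / (A + B) / B powr p) * Lpint p D g)"
proof -
  note [measurable] = measurable_Lp_integrand[OF D(1,2), of p] measurable_Lp_integrand[OF D(1,3), of p]
  have "Lpint p D (\<lambda>z. f z + g z) \<le> (\<integral>\<^sup>+ z. ennreal ((A + B) powr p) *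
           (ennreal (A / (A + B) / A powr p) * (indicator D z * ennreal (norm (f z) powr p)) +
            ennreal (B / (A + B) / B powr p) * (indicator D z * ennreal (norm (g z) powr p))) \<partial>lborel)"
  proof (rule nn_integral_mono)
    fix z :: "complex ^ 'a"
    have "norm (f z + g z) powr p \<le> (norm (f z) + norm (g z)) powr p"
      using p by (intro powr_mono2) (auto simp: norm_triangle_ineq)
    also have "\<dots> \<le> (A + B) powr p * (A / (A + B) * (norm (f z) / A) powr p + B / (A + B) * (norm (g z) / B) powr p)"
      using assms by (intro powr_add_le_weighted) auto
    also have "\<dots> = (A + B) powr p * (A / (A + B) / A powr p * norm (f z) powr p + B / (A + B) / B powr p * norm (g z) powr p)"
      using AB by (simp add: powr_divide)
    finally have *: "norm (f z + g z) powr p \<le> \<dots>" .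
    show "indicator D z * ennreal (norm (f z + g z) powr p) \<le> ennreal ((A + B) powr p) *
           (ennreal (A / (A + B) / A powr p) * (indicator D z * ennreal (norm (f z) powr p)) +
            ennreal (B / (A + B) / B powr p) * (indicator D z * ennreal (norm (g z) powr p)))"
      using * AB by (auto simp: indicator_def ennreal_mult[symmetric] ennreal_plus[symmetric] simp del: ennreal_plus)
  qed
  also have "\<dots> = ennreal ((A + B) powr p) *
           (ennreal (A / (A + B) / A powr p) * Lpint p D f + ennreal (B / (A + B) / B powr p) * Lpint p D g)"
    by (simp add: nn_integral_cmult nn_integral_add)
  finally show ?thesis .
qed

lemma Lpint_add_finite:
  assumes "open D" "continuous_on D f" "continuous_on D g" "p \<ge> 1"
    and "Lpint p D f < \<infinity>" "Lpint p D g < \<infinity>"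
  shows "Lpint p D (\<lambda>z. f z + g z) < \<infinity>"
  using le_less_trans[OF Lpint_add_le_weighted[OF assms(1-4), of 1 1], of \<infinity>] assms(5,6)
    ennreal_less_top[of "1/2"] ennreal_less_top[of "2 powr p"]
  by (simp add: ennreal_mult_less_top del: ennreal_less_top)

lemma Lpnorm_triangle:
  assumes D: "open D" "continuous_on D f" "continuous_on D g" and p: "p \<ge> 1"
    and fin: "Lpint p D f < \<infinity>" "Lpint p D g < \<infinity>"
  shows "Lpnorm p D (\<lambda>z. f z + g z) \<le> Lpnorm p D f + Lpnorm p D g"
proof (rule field_le_epsilon)
  fix e :: real assume e: "e > 0"
  \<comment> \<open>The norms are raised by \<open>e / 2\<close> because a norm may vanish while the
    weighted inequality divides by \<open>A\<close> and \<open>B\<close>.\<close>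
  define A where "A = Lpnorm p D f + e/2"
  define B where "B = Lpnorm p D g + e/2"
  have AB: "A > 0" "B > 0" using e by (auto simp: A_def B_def add_nonneg_pos)
  have le: "Lpint p D f \<le> ennreal (A powr p)" "Lpint p D g \<le> ennreal (B powr p)"
    using fin p e AB by (auto simp: Lpnorm_le_iff[symmetric] A_def B_def)
  have "Lpint p D (\<lambda>z. f z + g z) \<le> ennreal ((A + B) powr p) *
           (ennreal (A / (A + B) / A powr p) * Lpint p D f + ennreal (B / (A + B) / B powr p) * Lpint p D g)"
    by (rule Lpint_add_le_weighted[OF D p AB])
  also have "\<dots> \<le> ennreal ((A + B) powr p) *
           (ennreal (A / (A + B) / A powr p) * ennreal (A powr p) + ennreal (B / (A + B) / B powr p) * ennreal (B powr p))"
    by (intro mult_left_mono add_mono le) auto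
  also have "\<dots> = ennreal ((A + B) powr p)"
    using AB by (simp add: ennreal_mult[symmetric] ennreal_plus[symmetric] add_divide_distrib[symmetric] del: ennreal_plus)
  finally have "Lpnorm p D (\<lambda>z. f z + g z) \<le> A + B"
    using p AB by (intro Lpnorm_leI) auto
  then show "Lpnorm p D (\<lambda>z. f z + g z) \<le> Lpnorm p D f + Lpnorm p D g + e"
    by (simp add: A_def B_def)
qed

lemma Lpint_cmult:
  assumes "open D" "continuous_on D f"
  shows "Lpint p D (\<lambda>z. k * f z) = ennreal (norm k powr p) * Lpint p D f"
proof -
  note [measurable] = measurable_Lp_integrand[OF assms, of p]
  have "Lpint p D (\<lambda>z. k * f z) = (\<integral>\<^sup>+ z. ennreal (norm k powr p) * (indicator D z * ennreal (norm (f z) powr p)) \<partial>lborel)"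
    by (intro nn_integral_cong) (auto simp: norm_mult powr_mult ennreal_mult indicator_def)
  then show ?thesis by (simp add: nn_integral_cmult)
qed

lemma Lpnorm_cmult:
  assumes "open D" "continuous_on D f" "p > 0"
  shows "Lpnorm p D (\<lambda>z. k * f z) = norm k * Lpnorm p D f"
  using assms(3) unfolding Lpnorm_def Lpint_cmult[OF assms(1,2)]
  by (simp add: enn2real_mult powr_mult powr_powr)

lemma Lpnorm_mono_set:
  assumes "U \<subseteq> D" "Lpint p D f < \<infinity>" "p > 0"
  shows "Lpnorm p U f \<le> Lpnorm p D f"
  unfolding Lpnorm_def using assms Lpint_mono_set[OF assms(1), of f p]
  by (intro powr_mono2 enn2real_mono) auto

text \<open>Pointwise \<open>|f|^p <= 1 + |f|^r\<close>: the first summand covers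
  \<open>|f| <= 1\<close>, the second the rest. On a set of finite measure integrability thus
  descends to smaller exponents.\<close>

lemma Lpint_le_of_less_exponent:
  assumes D: "open D" "continuous_on D f" and "0 \<le> p" "p \<le> r"
  shows "Lpint p D f \<le> emeasure lborel D + Lpint r D f"
proof -
  note [measurable] = measurable_Lp_integrand[OF D]
  have [measurable]: "D \<in> sets borel" using D by auto
  have "norm (f z) powr p \<le> 1 + norm (f z) powr r" for z
  proof (cases "norm (f z) \<le> 1")
    case True
    then have "norm (f z) powr p \<le> 1" using assms powr_mono2[of p "norm (f z)" 1] by simp
    then show ?thesis by (simp add: add_increasing2)
  next
    case False
    then show ?thesis using powr_mono[of p r "norm (f z)"] assms by linarith
  qed
  then have "ennreal (norm (f z) powr p) \<le> 1 + ennreal (norm (f z) powr r)" for z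
    by (metis ennreal_1 ennreal_leI ennreal_plus powr_ge_zero zero_le_one)
  then have "Lpint p D f \<le> (\<integral>\<^sup>+ z. indicator D z + indicator D z * ennreal (norm (f z) powr r) \<partial>lborel)"
    by (intro nn_integral_mono) (auto simp: indicator_def)
  also have "\<dots> = emeasure lborel D + Lpint r D f"
    by (subst nn_integral_add) auto
  finally show ?thesis .
qed

text \<open>The set where \<open>f\<close> does not vanish is open by continuity and null by the
  vanishing integral, and a nonempty open set is not null. Hence distance zero will mean equality at
  every point, not just almost everywhere.\<close>

lemma Lpnorm_eq_0_imp:
  assumes D: "open D" "continuous_on D f" and p: "p > 0" and fin: "Lpint p D f < \<infinity>"
    and 0: "Lpnorm p D f = 0" and z: "z \<in> D"
  shows "f z = 0"
proof (rule ccontr)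
  assume nz: "f z \<noteq> 0"
  note [measurable] = measurable_Lp_integrand[OF D]
  define V where "V = {z \<in> D. f z \<noteq> 0}"
  have oV: "open V"
  proof -
    have "V = f -` (- {0}) \<inter> D" by (auto simp: V_def)
    then show ?thesis using D continuous_open_preimage[OF D(2,1), of "-{0}"] by (simp add: Int_commute open_Compl)
  qed
  have "Lpint p D f = 0" using Lpint_eq_Lpnorm[OF p fin] 0 p by simp
  then have "AE z in lborel. indicator D z * ennreal (norm (f z) powr p) = 0"
    by (subst (asm) nn_integral_0_iff_AE) auto
  then have "AE z in lborel. z \<notin> V"
    by eventually_elim (auto simp: V_def indicator_def split: if_splits)
  then have "emeasure lborel V = 0"
    using oV by (subst (asm) AE_iff_measurable[OF _ refl]) auto
  then have "V \<in> null_sets lborel" using oV by auto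
  then have "negligible V" by (simp add: negligible_iff_null_sets null_sets_completionI)
  then have "V = {}" using oV open_not_negligible by blast
  then show False using z nz by (auto simp: V_def)
qed

lemma OL_subset:
  assumes "f \<in> OL q V" "U \<subseteq> V"
  shows "f \<in> OL q U"
  using assms holo_on_subset[of f V U] Lpint_mono_set[OF assms(2), of f "real_of_ereal q"]
    bounded_subset[OF _ image_mono[OF assms(2)], of f]
  by (auto simp: OL_def intro: le_less_trans split: if_splits)

subsection \<open>The intersection space\<close>

lemma half_Suc_sums: "(\<lambda>i. (1/2::real) ^ Suc i) sums 1"
  using power_half_series .

lemma half_tail_suminf: "(\<Sum>i. (1/2::real) ^ Suc (i + n)) = (1/2) ^ n" "summable (\<lambda>i. (1/2::real) ^ Suc (i + n))"
proof -
  have "(\<lambda>i. (1/2) ^ n * (1/2::real) ^ Suc i) sums ((1/2) ^ n * 1)"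
    by (intro sums_mult half_Suc_sums)
  then have "(\<lambda>i. (1/2::real) ^ Suc (i + n)) sums ((1/2) ^ n)"
    by (simp add: power_add mult_ac)
  then show "(\<Sum>i. (1/2::real) ^ Suc (i + n)) = (1/2) ^ n" "summable (\<lambda>i. (1/2::real) ^ Suc (i + n))"
    by (auto simp: sums_iff)
qed

lemma frac_bounds: "0 \<le> x \<Longrightarrow> 0 \<le> x / (1 + x) \<and> x / (1 + x) \<le> 1" for x :: real
  by (auto simp: divide_simps)

lemma frac_mono: "0 \<le> x \<Longrightarrow> x \<le> y \<Longrightarrow> x / (1 + x) \<le> y / (1 + y)" for x y :: real
  by (simp add: divide_simps) (simp add: algebra_simps)

text \<open>The function space is studied over an open set of finite measure. The geometry of the
  ellipsoid enters only later, through one function lying outside all the relevant spaces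
  \<open>OL q U\<close>.\<close>

locale OL_scale =
  fixes q :: ereal and ps :: "nat \<Rightarrow> real" and D :: "(complex ^ 'n) set"
  assumes ps0: "1 < ps 0" and ps_mono: "strict_mono ps" and ps_lim: "(\<lambda>j. ereal (ps j)) \<longlonglongrightarrow> q"
    and open_D: "open D" and finite_D: "emeasure lborel D < \<infinity>"
begin

lemma ps_gt_1: "1 < ps j"
  using ps0 ps_mono strict_mono_less_eq[of ps 0 j] by simp

lemma ps_less_q: "ereal (ps j) < q"
proof -
  have "incseq (\<lambda>j. ereal (ps j))"
    using ps_mono by (auto simp: incseq_def strict_mono_less_eq)
  then have "ereal (ps (Suc j)) \<le> q" using ps_lim by (rule incseq_le)
  moreover have "ps j < ps (Suc j)" using ps_mono by (simp add: strict_mono_def)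
  ultimately show ?thesis by (meson ereal_less(2) less_ereal.simps(1) less_le_trans)
qed

lemma less_ps_exists:
  assumes "ereal p < q"
  obtains j where "p < ps j"
  using order_tendstoD(1)[OF ps_lim assms] by (auto simp: eventually_sequentially)

lemma OL_ps_iff: "f \<in> OL (ereal (ps j)) U \<longleftrightarrow> holo_on f U \<and> Lpint (ps j) U f < \<infinity>"
  by (simp add: OL_def)

text \<open>Each \<open>p < q\<close> lies below some \<open>p_j\<close>, and finite measure lets
  integrability descend from \<open>p_j\<close> to \<open>p\<close>. What remains are countably many
  conditions, the ones that the metric measures.\<close>

lemma OLbelow_iff:
  "f \<in> OLbelow q D \<longleftrightarrow> holo_on f D \<and> (\<forall>j. Lpint (ps j) D f < \<infinity>) \<and> (\<forall>z. z \<notin> D \<longrightarrow> f z = 0)"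
proof (intro iffI conjI)
  assume "f \<in> OLbelow q D"
  then have *: "f \<in> OL (ereal (ps j)) D" for j
    using ps_gt_1[of j] ps_less_q[of j] by (auto simp: OLbelow_def)
  then show "holo_on f D" "\<forall>j. Lpint (ps j) D f < \<infinity>" using OL_ps_iff by blast+
  show "\<forall>z. z \<notin> D \<longrightarrow> f z = 0" using \<open>f \<in> OLbelow q D\<close> by (auto simp: OLbelow_def)
next
  assume *: "holo_on f D \<and> (\<forall>j. Lpint (ps j) D f < \<infinity>) \<and> (\<forall>z. z \<notin> D \<longrightarrow> f z = 0)"
  have "f \<in> OL (ereal p) D" if p: "1 \<le> p" "ereal p < q" for p
  proof -
    obtain j where j: "p < ps j" using less_ps_exists[OF p(2)] .
    have "Lpint p D f \<le> emeasure lborel D + Lpint (ps j) D f"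
      using * p j by (intro Lpint_le_of_less_exponent open_D holo_on_imp_continuous_on) auto
    also have "\<dots> < \<infinity>" using * finite_D by (auto simp: less_top[symmetric])
    finally show ?thesis using * by (simp add: OL_def)
  qed
  then show "f \<in> OLbelow q D" using * by (auto simp: OLbelow_def)
qed

lemma OLbelow_cont: "f \<in> OLbelow q D \<Longrightarrow> continuous_on D f"
  using OLbelow_iff holo_on_imp_continuous_on by blast

lemma OLbelow_finite: "f \<in> OLbelow q D \<Longrightarrow> Lpint (ps j) D f < \<infinity>"
  using OLbelow_iff by blast

lemma OLbelow_add_cmult:
  assumes f: "f \<in> OLbelow q D" and g: "g \<in> OLbelow q D"
  shows "(\<lambda>z. f z + k * g z) \<in> OLbelow q D"
proof -
  have "Lpint (ps j) D (\<lambda>z. f z + k * g z) < \<infinity>" for j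
    using OLbelow_cont[OF f] OLbelow_cont[OF g] OLbelow_finite[OF f] OLbelow_finite[OF g] ps_gt_1[of j]
    by (intro Lpint_add_finite open_D continuous_intros)
       (auto simp: Lpint_cmult[OF open_D] ennreal_mult_less_top)
  then show ?thesis using f g by (auto simp: OLbelow_iff intro!: holo_on_add holo_on_cmult)
qed

lemma OLbelow_diff: "f \<in> OLbelow q D \<Longrightarrow> g \<in> OLbelow q D \<Longrightarrow> (\<lambda>z. f z - g z) \<in> OLbelow q D"
  using OLbelow_add_cmult[of f g "-1"] by simp

lemma Lpnorm_diff_triangle:
  assumes "f \<in> OLbelow q D" "g \<in> OLbelow q D" "h \<in> OLbelow q D" "open U" "U \<subseteq> D"
  shows "Lpnorm (ps j) U (\<lambda>z. f z - h z) \<le> Lpnorm (ps j) U (\<lambda>z. f z - g z) + Lpnorm (ps j) U (\<lambda>z. g z - h z)"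
proof -
  have fin: "Lpint (ps j) U f < \<infinity>" "continuous_on U f" if "f \<in> OLbelow q D" for f
    using that assms(5) OLbelow_finite[of f j] Lpint_mono_set[of U D f "ps j"] OLbelow_cont[of f]
    by (auto intro: le_less_trans continuous_on_subset)
  show ?thesis
    using Lpnorm_triangle[of U "\<lambda>z. f z - g z" "\<lambda>z. g z - h z" "ps j"] assms(4) ps_gt_1[of j]
      fin[OF OLbelow_diff[OF assms(1,2)]] fin[OF OLbelow_diff[OF assms(2,3)]]
    by simp
qed

section \<open>The metric of the intersection space\<close>

abbreviation "dterm f g j \<equiv> (1/2) ^ (Suc j) *
      (Lpnorm (ps j) D (\<lambda>z. f z - g z) / (1 + Lpnorm (ps j) D (\<lambda>z. f z - g z)))"

lemma dterm_nonneg: "0 \<le> dterm f g j"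
  using frac_bounds[OF Lpnorm_nonneg] by auto

lemma dterm_le: "dterm f g j \<le> (1/2) ^ (Suc j)"
  using frac_bounds[OF Lpnorm_nonneg] by (intro mult_left_le) auto

lemma summable_dterm: "summable (dterm f g)"
  using dterm_nonneg dterm_le
  by (intro summable_comparison_test[OF _ sums_summable[OF half_Suc_sums]] exI[of _ 0]) (auto simp del: power_Suc)

lemma dterm_le_OLdist: "dterm f g j \<le> OLdist ps D f g"
  unfolding OLdist_def
  using sum_le_suminf[OF summable_dterm, of "{j}" f g] dterm_nonneg by (auto simp del: power_Suc)

lemma Lpnorm_diff_commute: "Lpnorm p U (\<lambda>z. f z - g z) = Lpnorm p U (\<lambda>z. g z - f z)"
  by (simp add: Lpnorm_def norm_minus_commute)

lemma metric: "Metric_space (OLbelow q D) (OLdist ps D)"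
proof
  fix f g
  show "0 \<le> OLdist ps D f g"
    unfolding OLdist_def by (rule suminf_nonneg[OF summable_dterm dterm_nonneg])
  show "OLdist ps D f g = OLdist ps D g f"
    unfolding OLdist_def by (simp only: Lpnorm_diff_commute[where f = f and g = g])
next
  fix f g assume fg: "f \<in> OLbelow q D" "g \<in> OLbelow q D"
  show "(OLdist ps D f g = 0) = (f = g)"
  proof
    assume "OLdist ps D f g = 0"
    then have "dterm f g 0 \<le> 0" using dterm_le_OLdist[of 0 f g] by simp
    moreover have "1 + Lpnorm (ps 0) D (\<lambda>z. f z - g z) > 0" by (rule add_pos_nonneg) auto
    ultimately have *: "Lpnorm (ps 0) D (\<lambda>z. f z - g z) = 0"
      using Lpnorm_nonneg[of "ps 0" D "\<lambda>z. f z - g z"]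
      by (auto simp: mult_le_0_iff divide_le_0_iff simp del: Lpnorm_nonneg)
    have "f z = g z" for z
    proof (cases "z \<in> D")
      case True
      have "(\<lambda>z. f z - g z) z = 0"
        using ps_gt_1[of 0] * True
        by (intro Lpnorm_eq_0_imp[OF open_D OLbelow_cont[OF OLbelow_diff[OF fg]] _ OLbelow_finite[OF OLbelow_diff[OF fg]]]) auto
      then show ?thesis by simp
    next
      case False then show ?thesis using fg OLbelow_iff by auto
    qed
    then show "f = g" by auto
  next
    assume "f = g"
    then show "OLdist ps D f g = 0" using ps_gt_1 by (simp add: OLdist_def Lpnorm_def)
  qed
  fix h assume h: "h \<in> OLbelow q D"
  have "dterm f h j \<le> dterm f g j + dterm g h j" for j
  proof -
    define x where "x = Lpnorm (ps j) D (\<lambda>z. f z - g z)"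
    define y where "y = Lpnorm (ps j) D (\<lambda>z. g z - h z)"
    define w where "w = Lpnorm (ps j) D (\<lambda>z. f z - h z)"
    have nn: "0 \<le> x" "0 \<le> y" "0 \<le> w" by (auto simp: x_def y_def w_def)
    have "w \<le> x + y"
      using Lpnorm_diff_triangle[OF fg h open_D order_refl] by (simp add: x_def y_def w_def)
    then have "w / (1 + w) \<le> (x + y) / (1 + (x + y))" using nn by (intro frac_mono)
    also have "\<dots> = x / (1 + (x + y)) + y / (1 + (x + y))" by (simp add: add_divide_distrib)
    \<comment> \<open>Subadditivity of \<open>x / (1 + x)\<close>: dropping one summand of the
      common denominator enlarges each fraction.\<close>
    also have "\<dots> \<le> x / (1 + x) + y / (1 + y)"
      using nn by (intro add_mono divide_left_mono) (auto simp: add_nonneg_pos add_pos_nonneg)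
    finally have "(1/2) ^ Suc j * (w / (1 + w)) \<le> (1/2) ^ Suc j * (x / (1 + x) + y / (1 + y))"
      by (intro mult_left_mono) auto
    then show ?thesis unfolding x_def y_def w_def by (simp only: distrib_left)
  qed
  then have "(\<Sum>j. dterm f h j) \<le> (\<Sum>j. dterm f g j + dterm g h j)"
    by (intro suminf_le summable_dterm summable_add)
  then show "OLdist ps D f h \<le> OLdist ps D f g + OLdist ps D g h"
    unfolding OLdist_def by (simp only: suminf_add[OF summable_dterm summable_dterm])
qed

sublocale Metric_space "OLbelow q D" "OLdist ps D" by (rule metric)

section \<open>Integrability at q expressed through the norms at p_j\<close>

lemma OL_finite_q_iff_bounded_norms:
  assumes f: "holo_on f U" "\<And>j. Lpint (ps j) U f < \<infinity>" and U: "open U" "emeasure lborel U < \<infinity>"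
    and q: "q = ereal r"
  shows "f \<in> OL q U \<longleftrightarrow> (\<exists>N::nat. \<forall>j. Lpnorm (ps j) U f \<le> N)"
proof
  have fc: "continuous_on U f" using f(1) by (rule holo_on_imp_continuous_on)
  have psr: "ps j \<le> r" for j using ps_less_q[of j] q by simp
  have r: "r > 1" using psr[of 0] ps0 by simp
  {
    assume "f \<in> OL q U"
    then have fin: "Lpint r U f < \<infinity>" using q by (simp add: OL_def)
    define C where "C = enn2real (emeasure lborel U + Lpint r U f)"
    have C: "emeasure lborel U + Lpint r U f = ennreal C"
      using U(2) fin by (simp add: C_def)
    \<comment> \<open>With \<open>max 1 C\<close> as base, \<open>C <= (max 1 C)^p\<close> for every
      \<open>p >= 1\<close>, so the root of order \<open>p_j\<close> leaves a bound independent of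
      \<open>j\<close>.\<close>
    have "Lpnorm (ps j) U f \<le> max 1 C" for j
    proof (rule Lpnorm_leI)
      show "ps j > 0" using ps_gt_1[of j] by simp
      have "Lpint (ps j) U f \<le> ennreal C"
        unfolding C[symmetric] using ps_gt_1[of j] psr[of j]
        by (intro Lpint_le_of_less_exponent[OF U(1) fc]) auto
      also have "C \<le> max 1 C powr ps j"
        using powr_mono[of 1 "ps j" "max 1 C"] ps_gt_1[of j] by simp
      finally show "Lpint (ps j) U f \<le> ennreal (max 1 C powr ps j)"
        using ennreal_leI order_trans by blast
    qed auto
    moreover obtain N :: nat where "max 1 C \<le> N" using real_arch_simple by blast
    ultimately show "\<exists>N::nat. \<forall>j. Lpnorm (ps j) U f \<le> N" by (meson order_trans)
  }
  assume "\<exists>N::nat. \<forall>j. Lpnorm (ps j) U f \<le> N"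
  then obtain N :: nat where N: "\<And>j. Lpnorm (ps j) U f \<le> N" by blast
  \<comment> \<open>Again the base is at least 1, so the bounds with exponents \<open>p_j\<close>
    are all dominated by the power with exponent \<open>r\<close>.\<close>
  define M where "M = max 1 (real N) powr r"
  have le: "Lpint (ps j) U f \<le> ennreal M" for j
  proof -
    have "Lpint (ps j) U f \<le> ennreal (real N powr ps j)"
      using N[of j] ps_gt_1[of j] f(2)[of j] by (subst (asm) Lpnorm_le_iff) auto
    also have "real N powr ps j \<le> max 1 (real N) powr ps j"
      using ps_gt_1[of j] by (intro powr_mono2) auto
    also have "\<dots> \<le> M" unfolding M_def by (intro powr_mono psr) auto
    finally show ?thesis by (simp add: ennreal_leI)
  qed
  have "(\<lambda>j. ps j) \<longlonglongrightarrow> r" using ps_lim q by simp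
  then have lim: "(\<lambda>j. norm (f z) powr ps j) \<longlonglongrightarrow> norm (f z) powr r" for z
    by (cases "f z = 0") (auto intro!: tendsto_powr)
  have lim': "(\<lambda>j. indicator U z * ennreal (norm (f z) powr ps j)) \<longlonglongrightarrow> indicator U z * ennreal (norm (f z) powr r)" for z
    by (cases "z \<in> U") (auto intro!: tendsto_ennrealI lim)
  \<comment> \<open>Fatou's lemma along \<open>p_j -> r\<close>: the integrands converge pointwise
    and their integrals are at most \<open>M\<close>.\<close>
  have "Lpint r U f = (\<integral>\<^sup>+ z. liminf (\<lambda>j. indicator U z * ennreal (norm (f z) powr ps j)) \<partial>lborel)"
    by (intro nn_integral_cong lim_imp_Liminf[symmetric] lim') simp
  also have "\<dots> \<le> liminf (\<lambda>j. Lpint (ps j) U f)"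
    by (intro nn_integral_liminf measurable_Lp_integrand U fc)
  also have "\<dots> \<le> liminf (\<lambda>j. ennreal M)"
    by (intro Liminf_mono always_eventually allI le)
  also have "\<dots> < \<infinity>" by (simp add: Liminf_const)
  finally show "f \<in> OL q U" using f(1) q by (simp add: OL_def)
qed

text \<open>A common bound \<open>N\<close> of the norms forces \<open>|f| <= 2 * N\<close>. On the
  set \<open>V\<close> where this fails, Chebyshev's inequality gives
  \<open>2^p * vol V <= 1\<close> for \<open>p = p_j\<close>, and the \<open>p_j\<close> are
  unbounded. So \<open>V\<close> is null and, being open, empty.\<close>

lemma OL_infinity_iff_bounded_norms:
  assumes f: "holo_on f U" "\<And>j. Lpint (ps j) U f < \<infinity>" and U: "open U" "emeasure lborel U < \<infinity>"
    and q: "q = \<infinity>"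
  shows "f \<in> OL q U \<longleftrightarrow> (\<exists>N::nat. \<forall>j. Lpnorm (ps j) U f \<le> N)"
proof
  have fc: "continuous_on U f" using f(1) by (rule holo_on_imp_continuous_on)
  have [measurable]: "U \<in> sets borel" using U by auto
  {
    assume "f \<in> OL q U"
    then obtain M0 where M0: "\<And>z. z \<in> U \<Longrightarrow> norm (f z) \<le> M0" using q by (auto simp: OL_def bounded_iff)
    define M where "M = max 1 M0"
    have M: "\<And>z. z \<in> U \<Longrightarrow> norm (f z) \<le> M" "M \<ge> 1" using M0 by (auto simp: M_def intro: max.coboundedI2)
    define C where "C = measure lborel U"
    have C0: "0 \<le> C" by (simp add: C_def)
    have C: "emeasure lborel U = ennreal C" using U(2) by (simp add: C_def emeasure_eq_ennreal_measure)
    have "Lpnorm (ps j) U f \<le> M * max 1 C" for j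
    proof (rule Lpnorm_leI)
      show "ps j > 0" using ps_gt_1[of j] by simp
      have "Lpint (ps j) U f \<le> (\<integral>\<^sup>+ z. ennreal (M powr ps j) * indicator U z \<partial>lborel)"
        using ps_gt_1[of j] M
        by (intro nn_integral_mono) (auto simp: indicator_def intro!: ennreal_leI powr_mono2)
      also have "\<dots> = ennreal (M powr ps j * C)"
        using C0 by (simp add: nn_integral_cmult C ennreal_mult)
      also have "\<dots> \<le> ennreal ((M * max 1 C) powr ps j)"
      proof (rule ennreal_leI)
        have "C \<le> max 1 C powr ps j"
          using powr_mono[of 1 "ps j" "max 1 C"] ps_gt_1[of j] by simp
        then show "M powr ps j * C \<le> (M * max 1 C) powr ps j"
          using M(2) by (auto simp: powr_mult intro!: mult_left_mono)
      qed
      finally show "Lpint (ps j) U f \<le> ennreal ((M * max 1 C) powr ps j)" .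
    qed (use M in auto)
    moreover obtain N :: nat where "M * max 1 C \<le> N" using real_arch_simple by blast
    ultimately show "\<exists>N::nat. \<forall>j. Lpnorm (ps j) U f \<le> N" by (meson order_trans)
  }
  assume "\<exists>N::nat. \<forall>j. Lpnorm (ps j) U f \<le> N"
  then obtain N0 :: nat where "\<And>j. Lpnorm (ps j) U f \<le> N0" by blast
  \<comment> \<open>\<open>N >= 1\<close> is arranged so that \<open>N^p\<close> can be cancelled
    below.\<close>
  then obtain N where N: "\<And>j. Lpnorm (ps j) U f \<le> N" "N \<ge> (1::real)"
    by (metis max.cobounded1 max.coboundedI2)
  define V where "V = {z \<in> U. norm (f z) > 2 * N}"
  have oV: "open V"
  proof -
    have "V = U \<inter> f -` {w. norm w > 2 * N}" by (auto simp: V_def)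
    moreover have "open {w::complex. norm w > 2 * N}"
      by (intro open_Collect_less continuous_intros)
    ultimately show ?thesis using continuous_open_preimage[OF fc U(1)] by metis
  qed
  define v where "v = measure lborel V"
  have v0: "0 \<le> v" by (simp add: v_def)
  have "emeasure lborel V < \<infinity>"
    using emeasure_mono[of V U lborel] U by (auto simp: V_def intro: le_less_trans)
  then have v: "emeasure lborel V = ennreal v" by (simp add: v_def emeasure_eq_ennreal_measure)
  have "v * (ps j * ln 2) \<le> 1" for j
  proof -
    have "ennreal ((2 * N) powr ps j * v) = (\<integral>\<^sup>+ z. ennreal ((2 * N) powr ps j) * indicator V z \<partial>lborel)"
      using oV v0 by (simp add: nn_integral_cmult v ennreal_mult)
    also have "\<dots> \<le> Lpint (ps j) U f"
      using ps_gt_1[of j] N(2)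
      by (intro nn_integral_mono) (auto simp: indicator_def V_def intro!: ennreal_leI powr_mono2)
    also have "\<dots> \<le> ennreal (N powr ps j)"
      using N ps_gt_1[of j] f(2)[of j] by (subst Lpnorm_le_iff[symmetric]) auto
    finally have "(2 * N) powr ps j * v \<le> N powr ps j" by (subst (asm) ennreal_le_iff) auto
    then have "2 powr ps j * v \<le> 1" using N(2) by (simp add: powr_mult)
    moreover have "ps j * ln 2 \<le> 2 powr ps j"
      using exp_ge_add_one_self[of "ps j * ln 2"] by (simp add: powr_def del: exp_ge_add_one_self)
    ultimately show ?thesis
      by (smt (verit, best) measure_nonneg mult.commute mult_left_mono v_def)
  qed
  moreover have "\<exists>j. v * (ps j * ln 2) > 1" if "v > 0"
  proof -
    obtain j where "1 / (v * ln 2) < ps j" using less_ps_exists[of "1 / (v * ln 2)"] q by auto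
    then show ?thesis using that by (intro exI[of _ j]) (simp add: field_simps)
  qed
  ultimately have "v \<le> 0" by (meson not_le)
  then have "emeasure lborel V = 0" using v by (simp add: ennreal_eq_0_iff)
  then have "V \<in> null_sets lborel" using oV by auto
  then have "negligible V" by (simp add: negligible_iff_null_sets null_sets_completionI)
  then have "V = {}" using oV open_not_negligible by blast
  then have "bounded (f ` U)" unfolding bounded_iff V_def by (intro exI[of _ "2 * N"]) (auto simp: not_less)
  then show "f \<in> OL q U" using f(1) q by (simp add: OL_def)
qed

lemma OL_iff_bounded_norms:
  assumes "f \<in> OLbelow q D" and U: "open U" "U \<subseteq> D"
  shows "f \<in> OL q U \<longleftrightarrow> (\<exists>N::nat. \<forall>j. Lpnorm (ps j) U f \<le> N)"
proof -
  have 1: "holo_on f U" using assms OLbelow_iff holo_on_subset by blast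
  have 2: "Lpint (ps j) U f < \<infinity>" for j
    using OLbelow_finite[OF assms(1)] Lpint_mono_set[OF U(2)] by (rule le_less_trans[rotated])
  have 3: "emeasure lborel U < \<infinity>" using emeasure_mono[OF U(2), of lborel] open_D finite_D
    by (auto intro: le_less_trans)
  show ?thesis
  proof (cases q)
    case (real r) then show ?thesis using OL_finite_q_iff_bounded_norms[OF 1 2 U(1) 3] by blast
  next
    case PInf then show ?thesis using OL_infinity_iff_bounded_norms[OF 1 2 U(1) 3] by blast
  next
    case MInf then show ?thesis using ps_less_q[of 0] by simp
  qed
qed

section \<open>Open sets defined by large norms, and their countable intersections\<close>

lemma openin_large_norm:
  assumes U: "open U" "U \<subseteq> D"
  shows "openin mtopology {g \<in> OLbelow q D. \<exists>j. Lpnorm (ps j) U g > c}"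
  unfolding openin_mtopology
proof (intro conjI allI impI)
  fix g assume "g \<in> {g \<in> OLbelow q D. \<exists>j. Lpnorm (ps j) U g > c}"
  then obtain j where g: "g \<in> OLbelow q D" and j: "Lpnorm (ps j) U g > c" by blast
  define \<eta> where "\<eta> = Lpnorm (ps j) U g - c"
  have \<eta>: "\<eta> > 0" using j by (simp add: \<eta>_def)
  \<comment> \<open>This is the \<open>j\<close>-th term of the metric at norm
    \<open>\<eta>\<close>. Distance below \<open>r\<close> keeps that term smaller, so by
    monotonicity of \<open>x / (1 + x)\<close> the \<open>j\<close>-th norm of the difference stays
    below \<open>\<eta>\<close>.\<close>
  define r where "r = (1/2) ^ Suc j * (\<eta> / (1 + \<eta>))"
  have r: "r > 0" using \<eta> by (simp add: r_def)
  have "mball g r \<subseteq> {g \<in> OLbelow q D. \<exists>j. Lpnorm (ps j) U g > c}"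
  proof
    fix h assume "h \<in> mball g r"
    then have h: "h \<in> OLbelow q D" and d: "OLdist ps D g h < r" by (auto simp: in_mball)
    define x where "x = Lpnorm (ps j) D (\<lambda>z. g z - h z)"
    have "dterm g h j < r" using d dterm_le_OLdist le_less_trans by blast
    then have "x / (1 + x) < \<eta> / (1 + \<eta>)" unfolding r_def x_def by (simp only: mult_less_cancel_left_pos zero_less_power half_gt_zero_iff zero_less_one)
    then have "x < \<eta>" using frac_mono[of \<eta> x] \<eta> by linarith
    moreover have "Lpnorm (ps j) U (\<lambda>z. g z - h z) \<le> x"
      unfolding x_def using ps_gt_1[of j] OLbelow_finite[OF OLbelow_diff[OF g h]]
      by (intro Lpnorm_mono_set U) auto
    moreover have "Lpnorm (ps j) U (\<lambda>z. g z - (\<lambda>_. 0) z) \<le> Lpnorm (ps j) U (\<lambda>z. g z - h z) + Lpnorm (ps j) U (\<lambda>z. h z - (\<lambda>_. 0) z)"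
      using g h by (intro Lpnorm_diff_triangle U) (use OLbelow_diff[OF g g] in auto)
    ultimately have "Lpnorm (ps j) U h > c" using \<eta>_def by simp
    then show "h \<in> {g \<in> OLbelow q D. \<exists>j. Lpnorm (ps j) U g > c}" using h by blast
  qed
  then show "\<exists>r>0. mball g r \<subseteq> {g \<in> OLbelow q D. \<exists>j. Lpnorm (ps j) U g > c}" using r by blast
qed auto

lemma gdelta_not_OL:
  assumes "countable \<U>" "\<And>U. U \<in> \<U> \<Longrightarrow> open U \<and> U \<subseteq> D"
  shows "gdelta_in mtopology {g \<in> OLbelow q D. \<forall>U\<in>\<U>. g \<notin> OL q U}"
proof -
  define W where "W = (\<lambda>(U, N::nat). {g \<in> OLbelow q D. \<exists>j. Lpnorm (ps j) U g > N})"
  \<comment> \<open>Inserting the whole space keeps the intersection inside it when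
    \<open>\<U>\<close> is empty.\<close>
  have "{g \<in> OLbelow q D. \<forall>U\<in>\<U>. g \<notin> OL q U} = \<Inter> (insert (topspace mtopology) (W ` (\<U> \<times> UNIV)))"
  proof -
    have "g \<notin> OL q U \<longleftrightarrow> (\<forall>N. g \<in> W (U, N))" if "g \<in> OLbelow q D" "U \<in> \<U>" for g U
      using that assms(2)[of U] by (simp add: W_def OL_iff_bounded_norms not_le)
    then show ?thesis by (intro set_eqI) (simp, metis)
  qed
  moreover have "gdelta_in mtopology \<dots>"
    using assms openin_large_norm
    by (intro gdelta_in_Inter) (auto simp: W_def intro!: open_imp_gdelta_in)
  ultimately show ?thesis by simp
qed

section \<open>Density along lines\<close>

lemma OL_q_line_unique:
  assumes f: "f \<in> OLbelow q D" "g \<in> OLbelow q D" and U: "open U" "U \<subseteq> D"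
    and s: "(\<lambda>z. f z + of_real s * g z) \<in> OL q U" and t: "(\<lambda>z. f z + of_real t * g z) \<in> OL q U" 
    and g: "g \<notin> OL q U"
  shows "s = t"
proof (rule ccontr)
  assume st: "s \<noteq> t"
  obtain N M :: nat where N: "\<And>j. Lpnorm (ps j) U (\<lambda>z. f z + of_real s * g z) \<le> N"
    and M: "\<And>j. Lpnorm (ps j) U (\<lambda>z. f z + of_real t * g z) \<le> M"
    using s t f by (auto simp: OL_iff_bounded_norms[OF OLbelow_add_cmult U])
  \<comment> \<open>The two functions differ by \<open>(s - t) * g\<close>, so two exceptional
    parameters would put \<open>g\<close> itself into \<open>OL q U\<close>. Arguing with the norms
    at \<open>p_j\<close> treats finite and infinite \<open>q\<close> alike.\<close>
  have "Lpnorm (ps j) U g \<le> (N + M) / \<bar>s - t\<bar>" for j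
  proof -
    have gc: "continuous_on U g" using OLbelow_cont f U continuous_on_subset by blast
    have "\<bar>s - t\<bar> * Lpnorm (ps j) U g = Lpnorm (ps j) U (\<lambda>z. of_real (s - t) * g z)"
      using ps_gt_1[of j] by (subst Lpnorm_cmult[OF U(1) gc]) (auto simp del: of_real_diff)
    also have "\<dots> = Lpnorm (ps j) U (\<lambda>z. (f z + of_real s * g z) - (f z + of_real t * g z))"
      by (simp add: algebra_simps)
    also have "\<dots> \<le> Lpnorm (ps j) U (\<lambda>z. (f z + of_real s * g z) - (\<lambda>_. 0) z) + Lpnorm (ps j) U (\<lambda>z. (\<lambda>_. 0) z - (f z + of_real t * g z))"
      using f OLbelow_diff[of f f] by (intro Lpnorm_diff_triangle U OLbelow_add_cmult) auto
    also have "\<dots> \<le> N + M"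
      using N[of j] M[of j] Lpnorm_diff_commute[of "ps j" U "\<lambda>_. 0" "\<lambda>z. f z + of_real t * g z"] by simp
    finally show ?thesis using st by (simp add: field_simps)
  qed
  moreover obtain K :: nat where "(N + M) / \<bar>s - t\<bar> \<le> K" using real_arch_simple by blast
  ultimately have "g \<in> OL q U" using f OL_iff_bounded_norms[OF f(2) U] by (meson order_trans)
  then show False using g by simp
qed

text \<open>The terms of the metric from index \<open>n\<close> on add up to less than
  \<open>r / 2\<close> whatever \<open>t\<close> is, and the first \<open>n\<close> terms are
  bounded linearly in \<open>t\<close>.\<close>

lemma OLdist_line_small:
  assumes f: "f \<in> OLbelow q D" "g \<in> OLbelow q D" and r: "r > 0"
  shows "\<exists>\<delta>>0. \<forall>t. 0 < t \<and> t < \<delta> \<longrightarrow> OLdist ps D f (\<lambda>z. f z + of_real t * g z) < r"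
proof -
  define A where "A j = Lpnorm (ps j) D g" for j
  have A: "Lpnorm (ps j) D (\<lambda>z. f z - (f z + of_real t * g z)) = t * A j" if "t > 0" for t j
    using Lpnorm_cmult[OF open_D OLbelow_cont[OF f(2)], of "ps j" "- of_real t"] ps_gt_1[of j] that
    by (simp add: A_def)
  obtain n where n: "(1/2::real) ^ n < r / 2"
    using real_arch_pow_inv[of "r/2" "1/2"] r by auto
  define B where "B = (\<Sum>j<n. A j)"
  have B: "B \<ge> 0" by (simp add: B_def A_def sum_nonneg)
  \<comment> \<open>Chosen so that \<open>t * B <= r / 2\<close>; the summand 1 keeps the quotient
    meaningful when all the norms vanish.\<close>
  define \<delta> where "\<delta> = r / (2 * (B + 1))"
  have "OLdist ps D f (\<lambda>z. f z + of_real t * g z) < r" if t: "0 < t" "t < \<delta>" for t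
  proof -
    define h where "h = (\<lambda>z. f z + of_real t * g z)"
    have "OLdist ps D f h = (\<Sum>j. dterm f h (j + n)) + (\<Sum>j<n. dterm f h j)"
      unfolding OLdist_def by (rule suminf_split_initial_segment[OF summable_dterm])
    also have "(\<Sum>j. dterm f h (j + n)) \<le> (\<Sum>j. (1/2::real) ^ Suc (j + n))"
      by (intro suminf_le dterm_le summable_ignore_initial_segment[OF summable_dterm] half_tail_suminf(2))
    also have "\<dots> < r / 2" using n half_tail_suminf(1)[of n] by simp
    also have "(\<Sum>j<n. dterm f h j) \<le> (\<Sum>j<n. t * A j)"
    proof (rule sum_mono)
      fix j
      have tA: "0 \<le> t * A j" using t by (simp add: A_def)
      have "dterm f h j = (1/2) ^ Suc j * (t * A j / (1 + t * A j))" unfolding h_def A[OF t(1)] ..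
      also have "\<dots> \<le> 1 * (t * A j / (1 + t * A j))"
        using frac_bounds[OF tA] by (intro mult_right_mono power_le_one) auto
      also have "\<dots> \<le> t * A j" using tA using divide_left_mono[of 1 "1 + t * A j" "t * A j"] by simp
      finally show "dterm f h j \<le> t * A j" .
    qed
    also have "\<dots> = t * B" by (simp add: B_def sum_distrib_left)
    also have "t * B \<le> r / 2"
    proof -
      have "t * B \<le> \<delta> * (B + 1)" using t B by (intro mult_mono) auto
      also have "\<dots> = r / 2" unfolding \<delta>_def using B by (simp add: divide_simps)
      finally show ?thesis .
    qed
    finally show ?thesis by (simp add: h_def)
  qed
  moreover have "\<delta> > 0" using r B by (simp add: \<delta>_def)
  ultimately show ?thesis by blast
qed

lemma dense_not_OL:
  assumes \<U>: "countable \<U>" "\<And>U. U \<in> \<U> \<Longrightarrow> open U \<and> U \<subseteq> D"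
    and g: "g \<in> OLbelow q D" "\<And>U. U \<in> \<U> \<Longrightarrow> g \<notin> OL q U"
  shows "mtopology closure_of {g \<in> OLbelow q D. \<forall>U\<in>\<U>. g \<notin> OL q U} = OLbelow q D"
proof -
  have "\<exists>h\<in>{g \<in> OLbelow q D. \<forall>U\<in>\<U>. g \<notin> OL q U}. h \<in> mball f r"
    if f: "f \<in> OLbelow q D" and r: "r > 0" for f r
  proof -
    define h where "h t = (\<lambda>z. f z + of_real t * g z)" for t :: real
    obtain \<delta> where \<delta>: "\<delta> > 0" "\<And>t. 0 < t \<and> t < \<delta> \<Longrightarrow> OLdist ps D f (h t) < r"
      using OLdist_line_small[OF f g(1) r] unfolding h_def by blast
    define E where "E = (\<Union>U\<in>\<U>. {t. h t \<in> OL q U})"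
    have "countable {t. h t \<in> OL q U}" if "U \<in> \<U>" for U
    proof -
      have "{t. h t \<in> OL q U} \<subseteq> {t}" if "h t \<in> OL q U" for t
        using OL_q_line_unique[OF f g(1)] that \<U>(2) g(2) \<open>U \<in> \<U>\<close> unfolding h_def by blast
      then show ?thesis by (cases "{t. h t \<in> OL q U} = {}") (auto, meson countable_empty countable_insert countable_subset)
    qed
    then have "countable E" unfolding E_def using \<U>(1) by blast
    moreover have "uncountable {0<..<\<delta>}" using \<delta> by (simp add: uncountable_open_interval)
    ultimately obtain t where t: "t \<in> {0<..<\<delta>}" "t \<notin> E" by (meson countable_subset subsetI)
    have hX: "h t \<in> OLbelow q D" unfolding h_def by (intro OLbelow_add_cmult f g)
    show ?thesis using hX t \<delta>(2)[of t] f by (intro bexI[of _ "h t"]) (auto simp: E_def in_mball)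
  qed
  then show ?thesis unfolding metric_closure_of by auto
qed

end

subsection \<open>The Hermitian form of an ellipsoid\<close>

text \<open>With \<open>A\<close> fixed this is the uniqueness of Haar measure up to a scalar; taking for \<open>A\<close> a symmetric set
  preserved by a linear map \<open>H\<close> shows that \<open>H\<close> preserves Lebesgue measure, without determinants.\<close>

lemma translation_invariant_measure_swap:
  fixes \<mu> :: "'a::euclidean_space measure"
  assumes sets: "sets \<mu> = sets borel" and sf: "sigma_finite_measure \<mu>"
    and inv: "\<And>x B. B \<in> sets borel \<Longrightarrow> emeasure \<mu> ((+) x -` B) = emeasure \<mu> B"
    and A: "A \<in> sets borel" and B: "B \<in> sets borel"
  shows "emeasure lborel A * emeasure \<mu> B = emeasure lborel B * emeasure \<mu> (uminus -` A)"
proof -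
  have space: "space \<mu> = UNIV" using sets_eq_imp_space_eq[OF sets] by simp
  note [measurable_cong] = sets
  note [measurable] = A B
  interpret pair_sigma_finite lborel \<mu>
    by (intro pair_sigma_finite.intro sf) unfold_locales
  have "emeasure lborel A * emeasure \<mu> B = (\<integral>\<^sup>+ x. indicator A x * emeasure \<mu> B \<partial>lborel)"
    by (simp add: nn_integral_multc)
  \<comment> \<open>The double integral of \<open>1_A(x) * 1_B(x + y)\<close> is evaluated in both
    orders. Integrating over \<open>y\<close> first uses the invariance of \<open>\<mu>\<close>. The
    substitution \<open>x -> x - y\<close> uses that of \<open>lborel\<close> and leaves
    \<open>1_A(x - y)\<close>, which as a function of \<open>y\<close> is the indicator of a
    translate of the reflected set.\<close>
  also have "\<dots> = (\<integral>\<^sup>+ x. (\<integral>\<^sup>+ y. indicator A x * indicator B (x + y) \<partial>\<mu>) \<partial>lborel)"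
  proof (rule nn_integral_cong)
    fix x :: 'a
    have "(\<integral>\<^sup>+ y. indicator B (x + y) \<partial>\<mu>) = (\<integral>\<^sup>+ y. indicator ((+) x -` B) y \<partial>\<mu>)"
      by (intro nn_integral_cong) (auto simp: indicator_def)
    also have "\<dots> = emeasure \<mu> B"
      using inv[OF B, of x] measurable_sets[of "(+) x" borel borel B] sets by (subst nn_integral_indicator) auto
    finally show "indicator A x * emeasure \<mu> B = (\<integral>\<^sup>+ y. indicator A x * indicator B (x + y) \<partial>\<mu>)"
      by (subst nn_integral_cmult) auto
  qed
  also have "\<dots> = (\<integral>\<^sup>+ y. (\<integral>\<^sup>+ x. indicator A x * indicator B (x + y) \<partial>lborel) \<partial>\<mu>)"
    by (intro Fubini'[symmetric]) measurable
  also have "\<dots> = (\<integral>\<^sup>+ y. (\<integral>\<^sup>+ x. indicator A (x - y) * indicator B x \<partial>lborel) \<partial>\<mu>)"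
  proof (rule nn_integral_cong)
    fix y :: 'a
    have "(\<integral>\<^sup>+ x. indicator A (x - y) * indicator B x \<partial>lborel) =
          (\<integral>\<^sup>+ x. indicator A (x - y) * indicator B x \<partial>(distr lborel borel ((+) y)))"
      by (simp add: lborel_distr_plus)
    also have "\<dots> = (\<integral>\<^sup>+ x. indicator A x * indicator B (x + y) \<partial>lborel)"
      by (subst nn_integral_distr) (auto simp: add.commute)
    finally show "(\<integral>\<^sup>+ x. indicator A x * indicator B (x + y) \<partial>lborel) =
      (\<integral>\<^sup>+ x. indicator A (x - y) * indicator B x \<partial>lborel)" by simp
  qed
  also have "\<dots> = (\<integral>\<^sup>+ x. (\<integral>\<^sup>+ y. indicator A (x - y) * indicator B x \<partial>\<mu>) \<partial>lborel)"
    by (intro Fubini') measurable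
  also have "\<dots> = (\<integral>\<^sup>+ x. indicator B x * emeasure \<mu> (uminus -` A) \<partial>lborel)"
  proof (rule nn_integral_cong)
    fix x :: 'a
    have mA: "uminus -` A \<in> sets borel"
      using measurable_sets[of uminus borel borel A] A by auto
    have mA': "(+) (- x) -` (uminus -` A) \<in> sets borel"
      using measurable_sets[of "(+) (-x)" borel borel "uminus -` A"] mA by auto
    have "(\<integral>\<^sup>+ y. indicator A (x - y) \<partial>\<mu>) = (\<integral>\<^sup>+ y. indicator ((+) (- x) -` (uminus -` A)) y \<partial>\<mu>)"
      by (intro nn_integral_cong) (auto simp: indicator_def)
    also have "\<dots> = emeasure \<mu> (uminus -` A)"
      using inv[OF mA, of "-x"] mA' sets by (subst nn_integral_indicator) auto
    finally show "(\<integral>\<^sup>+ y. indicator A (x - y) * indicator B x \<partial>\<mu>) = indicator B x * emeasure \<mu> (uminus -` A)"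
      by (subst nn_integral_multc) (auto simp: mult.commute)
  qed
  also have "\<dots> = emeasure lborel B * emeasure \<mu> (uminus -` A)"
    by (simp add: nn_integral_multc)
  finally show ?thesis .
qed

section \<open>The Hermitian form and its norm\<close>

definition hform :: "('n::finite \<Rightarrow> real) \<Rightarrow> complex ^ 'n \<Rightarrow> complex ^ 'n \<Rightarrow> complex" where
  "hform a z w = (\<Sum>j\<in>UNIV. z $ j * cnj (w $ j) / of_real ((a j)\<^sup>2))"

text \<open>Written with \<open>L2_set\<close>, so that the triangle and Cauchy-Schwarz inequalities
  are those of finite square sums.\<close>

definition hnorm :: "('n::finite \<Rightarrow> real) \<Rightarrow> complex ^ 'n \<Rightarrow> real" where
  "hnorm a z = L2_set (\<lambda>j. cmod (z $ j) / a j) UNIV"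

lemma hform_add_left: "hform a (z + z') w = hform a z w + hform a z' w"
  by (simp add: hform_def sum.distrib[symmetric] algebra_simps add_divide_distrib)

lemma hform_smult_left: "hform a (c *s z) w = c * hform a z w"
  by (simp add: hform_def sum_distrib_left algebra_simps)

lemma hform_diff_left: "hform a (z - z') w = hform a z w - hform a z' w"
  by (simp add: hform_def sum_subtractf[symmetric] algebra_simps diff_divide_distrib)

lemma hform_cnj: "cnj (hform a z w) = hform a w z"
  by (simp add: hform_def mult.commute)

lemma hform_diff_right: "hform a w (z - z') = hform a w z - hform a w z'"
  by (metis complex_cnj_diff hform_cnj hform_diff_left)

lemma hform_smult_right: "hform a w (c *s z) = cnj c * hform a w z"
  by (metis complex_cnj_mult hform_cnj hform_smult_left)

lemma hform_self: "hform a z z = of_real ((hnorm a z)\<^sup>2)"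
  by (simp add: hform_def hnorm_def L2_set_def sum_nonneg complex_norm_square[symmetric] power_divide)

lemma hnorm_nonneg [simp]: "0 \<le> hnorm a z"
  by (simp add: hnorm_def)

lemma hnorm_triangle: "hnorm a (z + w) \<le> hnorm a z + hnorm a w" if "\<forall>j. 0 < a j"
proof -
  have "hnorm a (z + w) \<le> L2_set (\<lambda>j. cmod (z $ j) / a j + cmod (w $ j) / a j) UNIV"
    unfolding hnorm_def using that
    by (intro L2_set_mono) (auto simp: add_divide_distrib[symmetric] less_imp_le intro!: divide_right_mono norm_triangle_ineq)
  also have "\<dots> \<le> hnorm a z + hnorm a w"
    unfolding hnorm_def by (rule L2_set_triangle_ineq)
  finally show ?thesis .
qed

lemma hnorm_scaleR: "hnorm a (c *\<^sub>R z) = \<bar>c\<bar> * hnorm a z"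
  unfolding hnorm_def by (subst L2_set_right_distrib) auto

lemma hform_le: "cmod (hform a z w) \<le> hnorm a z * hnorm a w"
proof -
  have "cmod (hform a z w) \<le> (\<Sum>j\<in>UNIV. \<bar>cmod (z $ j) / a j\<bar> * \<bar>cmod (w $ j) / a j\<bar>)"
    unfolding hform_def by (rule order_trans[OF norm_sum]) (simp add: norm_mult norm_divide power2_eq_square norm_power)
  also have "\<dots> \<le> hnorm a z * hnorm a w"
    unfolding hnorm_def by (rule L2_set_mult_ineq)
  finally show ?thesis .
qed

text \<open>Together with \<open>norm_le_hnorm\<close> this gives equivalence with the Euclidean
  norm; sums over \<open>j\<close> in place of maxima are precise enough.\<close>

lemma hnorm_le_norm:
  assumes "\<forall>j. 0 < a j"
  shows "hnorm a z \<le> (\<Sum>j\<in>UNIV. 1 / a j) * norm z"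
proof -
  have "cmod (z $ j) / a j \<le> (\<Sum>j\<in>UNIV. 1 / a j) * cmod (z $ j)" for j
    using assms mult_right_mono[OF member_le_sum[of j UNIV "\<lambda>j. 1 / a j"], of "cmod (z $ j)"]
    by (simp add: less_imp_le)
  then have "hnorm a z \<le> L2_set (\<lambda>j. (\<Sum>j\<in>UNIV. 1 / a j) * cmod (z $ j)) UNIV"
    unfolding hnorm_def using assms by (intro L2_set_mono) (auto simp: less_imp_le)
  also have "\<dots> = (\<Sum>j\<in>UNIV. 1 / a j) * norm z"
    using assms by (subst L2_set_right_distrib[symmetric]) (auto simp: norm_vec_def less_imp_le intro!: sum_nonneg)
  finally show ?thesis .
qed

lemma norm_le_hnorm:
  assumes "\<forall>j. 0 < a j"
  shows "norm z \<le> (\<Sum>j\<in>UNIV. a j) * hnorm a z"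
proof -
  have "cmod (z $ j) \<le> (\<Sum>j\<in>UNIV. a j) * (cmod (z $ j) / a j)" for j
  proof -
    have "a j * (cmod (z $ j) / a j) \<le> (\<Sum>j\<in>UNIV. a j) * (cmod (z $ j) / a j)"
      using assms by (intro mult_right_mono member_le_sum) (auto simp: less_imp_le)
    then show ?thesis using assms[rule_format, of j] by simp
  qed
  then have "norm z \<le> L2_set (\<lambda>j. (\<Sum>j\<in>UNIV. a j) * (cmod (z $ j) / a j)) UNIV"
    unfolding norm_vec_def by (intro L2_set_mono) auto
  also have "\<dots> = (\<Sum>j\<in>UNIV. a j) * hnorm a z"
    using assms by (subst L2_set_right_distrib[symmetric]) (auto simp: hnorm_def less_imp_le intro!: sum_nonneg)
  finally show ?thesis .
qed

lemma continuous_on_hnorm: "continuous_on UNIV (hnorm a)"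
  unfolding hnorm_def L2_set_def divide_inverse by (intro continuous_intros)

lemma measurable_hnorm [measurable]: "hnorm a \<in> borel_measurable borel"
  by (intro borel_measurable_continuous_onI continuous_on_hnorm)

lemma ellipsoid_eq: "ellipsoid a = {z. hnorm a z < 1}"
  by (simp add: ellipsoid_def hnorm_def L2_set_def power_divide)

lemma open_ellipsoid: "open (ellipsoid a)"
  unfolding ellipsoid_eq by (intro open_Collect_less continuous_on_hnorm continuous_intros)

lemma bounded_hnorm_less:
  assumes "\<forall>j. 0 < a j"
  shows "bounded {z. hnorm a z < r}"
proof -
  have "norm z \<le> (\<Sum>j\<in>UNIV. a j) * r" if "hnorm a z < r" for z
    using norm_le_hnorm[OF assms, of z] that assms
    by (meson less_imp_le mult_left_mono order_trans sum_nonneg)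
  then show ?thesis by (auto simp: bounded_iff)
qed

lemma convex_hnorm_less:
  assumes "\<forall>j. 0 < a j"
  shows "convex {z. hnorm a z < r}"
proof (rule convexI)
  fix x y u v assume *: "x \<in> {z. hnorm a z < r}" "y \<in> {z. hnorm a z < r}" "0 \<le> u" "0 \<le> v" "u + v = (1::real)"
  have "hnorm a (u *\<^sub>R x + v *\<^sub>R y) \<le> u * hnorm a x + v * hnorm a y"
    using hnorm_triangle[OF assms, of "u *\<^sub>R x" "v *\<^sub>R y"] * by (simp add: hnorm_scaleR)
  also have "\<dots> < r" using convex_bound_lt[of "hnorm a x" r "hnorm a y" u v] * by auto
  finally show "u *\<^sub>R x + v *\<^sub>R y \<in> {z. hnorm a z < r}" by simp
qed

lemma frontier_ellipsoid_subset: "frontier (ellipsoid a) \<subseteq> {z. hnorm a z = 1}"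
proof -
  have "closed {z. hnorm a z \<le> 1}" by (intro closed_Collect_le continuous_on_hnorm continuous_intros)
  then have "closure (ellipsoid a) \<subseteq> {z. hnorm a z \<le> 1}"
    by (intro closure_minimal) (auto simp: ellipsoid_eq)
  then show ?thesis using interior_open[OF open_ellipsoid, of a]
    by (auto simp: frontier_def ellipsoid_eq)
qed

text \<open>The map \<open>H\<close> is a complex Householder reflection in the direction \<open>\<zeta> - \<xi>\<close>, with the phase of the
  eigenvalue adjusted so that \<open>\<zeta>\<close> goes to \<open>\<xi>\<close> exactly; when \<open>\<zeta> = \<xi>\<close> division by zero makes it the identity.\<close>

lemma unitary_transitive:
  assumes a: "\<forall>j. 0 < a j" and "hnorm a \<zeta> = 1" "hnorm a \<xi> = 1"
  obtains H where "linear H" "\<And>z w. hform a (H z) (H w) = hform a z w" "H \<zeta> = \<xi>"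
proof -
  define v where "v = \<zeta> - \<xi>"
  define \<alpha> where "\<alpha> = hform a \<zeta> v"
  define H where "H z = z - (hform a z v / \<alpha>) *s v" for z
  have \<alpha>: "\<alpha> = 1 - hform a \<zeta> \<xi>" using assms by (simp add: \<alpha>_def v_def hform_diff_right hform_self)
  \<comment> \<open>Since \<open>\<zeta>\<close> and \<open>\<xi>\<close> are unit vectors, both
    sides equal \<open>2 - 2 * Re (hform a \<zeta> \<xi>)\<close>.\<close>
  have vv: "hform a v v = \<alpha> + cnj \<alpha>"
    using assms unfolding v_def hform_diff_right hform_diff_left hform_self[of a \<zeta>] hform_self[of a \<xi>]
    by (simp add: \<alpha> hform_cnj)
  have "linear H"
  proof
    fix x y c
    show "H (x + y) = H x + H y"
      by (simp add: H_def hform_add_left add_divide_distrib vector_sadd_rdistrib)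
    have "c *\<^sub>R x = of_real c *s x" for c and x :: "complex ^ 'a"
      by (subst vec_eq_iff) (simp add: scaleR_conv_of_real[where x = "x $ _"])
    then show "H (c *\<^sub>R x) = c *\<^sub>R H x"
      by (simp add: H_def hform_smult_left vector_ssub_ldistrib)
  qed
  moreover have "hform a (H z) (H w) = hform a z w" for z w
  proof -
    have "hform a (H z) (H w) = hform a z w - hform a z v / \<alpha> * hform a v w
       - cnj (hform a w v / \<alpha>) * (hform a z v - hform a z v / \<alpha> * (\<alpha> + cnj \<alpha>))"
      unfolding H_def hform_diff_left hform_diff_right hform_smult_left hform_smult_right vv ..
    \<comment> \<open>For nonzero \<open>\<alpha>\<close> the coefficient of
      \<open>hform a z v * hform a v w\<close> is \<open>- 1 / \<alpha> - 1 / cnj \<alpha> +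
      (\<alpha> + cnj \<alpha>) / (\<alpha> * cnj \<alpha>)\<close>, which is zero.\<close>
    also have "\<dots> = hform a z w"
      by (cases "\<alpha> = 0") (simp_all add: hform_cnj field_simps)
    finally show ?thesis .
  qed
  moreover have "H \<zeta> = \<xi>"
  proof (cases "\<alpha> = 0")
    case True
    then have "hnorm a v = 0" using vv hform_self[of a v] by simp
    then have "v = 0" using norm_le_hnorm[OF a, of v] by simp
    then show ?thesis by (simp add: H_def v_def)
  next
    case False
    then have "H \<zeta> = \<zeta> - v" unfolding H_def \<alpha>_def[symmetric] by simp
    then show ?thesis by (simp add: v_def)
  qed
  ultimately show ?thesis using that by blast
qed

lemma unitary_hnorm:
  assumes "\<And>z w. hform a (H z) (H w) = hform a z w"
  shows "hnorm a (H z) = hnorm a z"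
proof -
  have "complex_of_real ((hnorm a (H z))\<^sup>2) = of_real ((hnorm a z)\<^sup>2)"
    using assms[of z z] by (simp only: hform_self)
  then show ?thesis by (simp only: of_real_eq_iff) (simp add: power2_eq_iff_nonneg)
qed

text \<open>The pushforward of Lebesgue measure under \<open>H\<close> is translation invariant: as
  \<open>H\<close> is onto, a translation by \<open>x\<close> after \<open>H\<close> is a
  translation by a preimage of \<open>x\<close> before it. The ellipsoid is symmetric, invariant
  under \<open>H\<close> and of positive finite volume, so comparing on it shows that the scalar is
  1.\<close>

lemma unitary_preserves_lborel:
  assumes a: "\<forall>j. 0 < a j" and H: "linear H" "\<And>z w. hform a (H z) (H w) = hform a z w"
  shows "distr lborel borel H = lborel"
proof -
  note hn = unitary_hnorm[OF H(2)]
  have "inj H"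
  proof (rule linear_injective_0[OF H(1), THEN iffD2], intro allI impI)
    fix x assume "H x = 0"
    then have "hnorm a x = 0" using hn[of x] by (simp add: hnorm_def L2_set_def)
    then show "x = 0" using norm_le_hnorm[OF a, of x] by simp
  qed
  then have sH: "surj H" using H(1) linear_injective_imp_surjective by blast
  have [measurable]: "H \<in> borel_measurable borel"
    using H(1) by (intro borel_measurable_continuous_onI linear_continuous_on linear_conv_bounded_linear[THEN iffD1])
  define \<mu> where "\<mu> = distr lborel borel H"
  have sets: "sets \<mu> = sets borel" by (simp add: \<mu>_def)
  have E: "emeasure \<mu> {z. hnorm a z < r} = emeasure lborel {z. hnorm a z < r}" for r
    unfolding \<mu>_def by (subst emeasure_distr) (auto simp: hn vimage_def)
  have fin: "emeasure lborel {z. hnorm a z < r} < \<infinity>" for r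
    using emeasure_bounded_finite[OF bounded_hnorm_less[OF a]] by auto
  have "sigma_finite_measure \<mu>"
  proof
    show "\<exists>A. countable A \<and> A \<subseteq> sets \<mu> \<and> \<Union> A = space \<mu> \<and> (\<forall>a\<in>A. emeasure \<mu> a \<noteq> \<infinity>)"
    proof (intro exI[of _ "range (\<lambda>n::nat. {z. hnorm a z < n})"] conjI)
      show "\<Union> (range (\<lambda>n::nat. {z. hnorm a z < n})) = space \<mu>"
        using reals_Archimedean2 by (auto simp: \<mu>_def)
    qed (use E fin in \<open>auto simp: sets less_top\<close>)
  qed
  moreover have "emeasure \<mu> ((+) x -` B) = emeasure \<mu> B" if B: "B \<in> sets borel" for x B
  proof -
    obtain u where u: "H u = x" using sH by (metis surjD)
    have [measurable]: "B \<in> sets borel" "(+) x -` B \<in> sets borel"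
      using B measurable_sets[of "(+) x" borel borel B] by auto
    have [measurable]: "H -` B \<in> sets borel" using measurable_sets[of H borel borel B] by auto
    have "emeasure \<mu> ((+) x -` B) = emeasure lborel ((+) u -` (H -` B))"
      unfolding \<mu>_def by (subst emeasure_distr) (auto simp: u[symmetric] linear_add[OF H(1)] vimage_def)
    also have "\<dots> = emeasure (distr lborel borel ((+) u)) (H -` B)"
      by (subst emeasure_distr) auto
    also have "\<dots> = emeasure \<mu> B"
      unfolding \<mu>_def lborel_distr_plus by (subst emeasure_distr) auto
    finally show ?thesis .
  qed
  ultimately have swap: "emeasure lborel (ellipsoid a) * emeasure \<mu> B
      = emeasure lborel B * emeasure \<mu> (uminus -` ellipsoid a)" if "B \<in> sets borel" for B
    using that by (intro translation_invariant_measure_swap sets) (auto simp: open_ellipsoid)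
  have "uminus -` ellipsoid a = ellipsoid a"
    by (auto simp: ellipsoid_eq hnorm_def)
  then have *: "emeasure lborel (ellipsoid a) * emeasure \<mu> B = emeasure lborel (ellipsoid a) * emeasure lborel B"
    if "B \<in> sets borel" for B
    using swap[OF that] E[of 1] by (simp add: ellipsoid_eq mult.commute)
  have "emeasure lborel (ellipsoid a) \<noteq> 0"
  proof
    assume "emeasure lborel (ellipsoid a) = 0"
    then have "ellipsoid a \<in> null_sets lborel" using open_ellipsoid[of a] by auto
    then have "negligible (ellipsoid a)" by (simp add: negligible_iff_null_sets null_sets_completionI)
    moreover have "0 \<in> ellipsoid a" by (simp add: ellipsoid_def)
    ultimately show False using open_not_negligible[OF open_ellipsoid] by blast
  qed
  moreover have "emeasure lborel (ellipsoid a) \<noteq> top" using fin[of 1] by (simp add: ellipsoid_eq)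
  ultimately have "emeasure \<mu> B = emeasure lborel B" if "B \<in> sets borel" for B
    using *[OF that] by (simp add: ennreal_mult_cancel_left)
  then show ?thesis unfolding \<mu>_def[symmetric] by (intro measure_eqI) (auto simp: sets)
qed

subsection \<open>Volumes of caps\<close>

text \<open>Over the reals each complex coordinate contributes the two basis vectors
  \<open>axis j 1\<close> and \<open>axis j \<i>\<close>. Grouping them yields one planar factor per
  coordinate, of order \<open>t^2\<close> or \<open>t\<close> in the volumes below.\<close>

lemma prod_Basis_complex_vec:
  "(\<Prod>b\<in>(Basis :: (complex ^ 'n) set). f b) = (\<Prod>j\<in>UNIV. f (axis j 1) * f (axis j \<i>))"
proof -
  have "bij_betw (\<lambda>(j, u). axis j u) (UNIV \<times> Basis) (Basis :: (complex ^ 'n) set)"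
    by (auto simp: bij_betw_def inj_on_def axis_eq_axis Basis_complex_def Basis_vec_def)
  then have "(\<Prod>b\<in>(Basis :: (complex ^ 'n) set). f b) = (\<Prod>(j, u)\<in>UNIV \<times> Basis. f (axis j u))"
    by (subst prod.reindex_bij_betw[symmetric]) (auto simp: case_prod_unfold)
  also have "\<dots> = (\<Prod>j\<in>UNIV. \<Prod>u\<in>Basis. f (axis j u))" by (rule prod.cartesian_product[symmetric])
  finally show ?thesis by (simp add: Basis_complex_def)
qed

lemma mem_box_complex_vec:
  fixes l u :: "complex ^ 'n"
  shows "z \<in> box l u \<longleftrightarrow> (\<forall>j. Re (l $ j) < Re (z $ j) \<and> Re (z $ j) < Re (u $ j) \<and>
                           Im (l $ j) < Im (z $ j) \<and> Im (z $ j) < Im (u $ j))"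
  by (auto simp: mem_box Basis_vec_def Basis_complex_def inner_axis)

lemma emeasure_box_complex_vec:
  fixes l u :: "complex ^ 'n"
  assumes "\<And>j. Re (l $ j) \<le> Re (u $ j)" "\<And>j. Im (l $ j) \<le> Im (u $ j)"
  shows "emeasure lborel (box l u) =
    ennreal (\<Prod>j\<in>UNIV. (Re (u $ j) - Re (l $ j)) * (Im (u $ j) - Im (l $ j)))"
proof -
  have "\<forall>b\<in>Basis. l \<bullet> b \<le> u \<bullet> b"
    using assms by (auto simp: Basis_vec_def Basis_complex_def inner_axis)
  then show ?thesis
    by (simp add: emeasure_lborel_box_eq prod_Basis_complex_vec inner_axis)
qed

lemma hnorm_split: "(hnorm a z)\<^sup>2 = (cmod (z $ k) / a k)\<^sup>2 + (\<Sum>j\<in>UNIV-{k}. (cmod (z $ j) / a j)\<^sup>2)"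
  by (simp add: hnorm_def L2_set_def sum_nonneg sum.remove[of UNIV k])

text \<open>At this boundary point the pairing involves a single coordinate. It is the model point
  to which all others are moved.\<close>

lemma hform_axis: "a k > 0 \<Longrightarrow> hform a z (axis k (of_real (a k))) = z $ k / of_real (a k)"
  by (simp add: hform_def axis_def sum.remove[of UNIV k] power2_eq_square if_distrib cong: if_cong)

lemma hnorm_axis:
  assumes "a k > 0"
  shows "hnorm a (axis k (of_real (a k))) = 1"
proof -
  have "(hnorm a (axis k (of_real (a k))))\<^sup>2 = 1\<^sup>2"
    using assms hnorm_split[of a "axis k (of_real (a k))" k] by (simp add: axis_def)
  then show ?thesis by (rule power2_eq_imp_eq) auto
qed

text \<open>A cap of size \<open>t\<close> is contained in a box of side \<open>O(t)\<close> in the complex normal direction and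
  \<open>O(sqrt t)\<close> in the others, which gives the exponent \<open>2 + (n - 1) = n + 1\<close>; conversely a box of
  that shape fits into the ellipsoid.\<close>

lemma cap_volume_axis:
  fixes a :: "'n::finite \<Rightarrow> real"
  assumes a: "\<forall>j. 0 < a j"
  obtains C where "0 \<le> C" "\<And>t. 0 < t \<Longrightarrow>
    emeasure lborel {z \<in> ellipsoid a. cmod (1 - hform a z (axis k (of_real (a k)))) < t} \<le> ennreal (C * t ^ (CARD('n) + 1))"
proof
  let ?C = "(2 * a k)\<^sup>2 * (\<Prod>j\<in>UNIV-{k}. 8 * (a j)\<^sup>2)"
  show "0 \<le> ?C" by (intro mult_nonneg_nonneg prod_nonneg) auto
  fix t :: real assume t: "0 < t"
  \<comment> \<open>With \<open>w = |z_k| / a_k\<close>, membership in the cap gives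
    \<open>1 - w < t\<close>. The ellipsoid then leaves less than
    \<open>1 - w^2 = (1 - w) * (1 + w) <= 2 * t\<close> for the square of any other
    \<open>|z_j| / a_j\<close>.\<close>
  define s where "s j = a j * sqrt (2 * t)" for j
  have s: "0 < s j" for j using a t by (simp add: s_def)
  define l :: "complex ^ 'n" where "l = (\<chi> j. if j = k then Complex (a k * (1 - t)) (- a k * t) else Complex (- s j) (- s j))"
  define u :: "complex ^ 'n" where "u = (\<chi> j. if j = k then Complex (a k * (1 + t)) (a k * t) else Complex (s j) (s j))"
  have ak: "a k > 0" using a by simp
  have "{z \<in> ellipsoid a. cmod (1 - hform a z (axis k (of_real (a k)))) < t} \<subseteq> box l u"
  proof
    fix z assume "z \<in> {z \<in> ellipsoid a. cmod (1 - hform a z (axis k (of_real (a k)))) < t}"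
    then have z: "hnorm a z < 1" and zk: "cmod (1 - z $ k / of_real (a k)) < t"
      using ak by (auto simp: ellipsoid_eq hform_axis)
    have "cmod (of_real (a k) - z $ k) = a k * cmod (1 - z $ k / of_real (a k))"
    proof -
      have "of_real (a k) - z $ k = of_real (a k) * (1 - z $ k / of_real (a k))"
        using ak by (simp add: field_simps)
      then show ?thesis using ak by (simp only: norm_mult) simp
    qed
    also have "\<dots> < a k * t" using zk ak by simp
    finally have "cmod (of_real (a k) - z $ k) < a k * t" .
    then have k: "\<bar>a k - Re (z $ k)\<bar> < a k * t" "\<bar>Im (z $ k)\<bar> < a k * t"
      using abs_Re_le_cmod[of "of_real (a k) - z $ k"] abs_Im_le_cmod[of "of_real (a k) - z $ k"] by auto
    have "\<bar>Re (z $ j)\<bar> < s j \<and> \<bar>Im (z $ j)\<bar> < s j" if "j \<noteq> k" for j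
    proof -
      have z2: "(hnorm a z)\<^sup>2 < 1" using z by (simp add: power_less_one_iff)
      define w where "w = cmod (z $ k) / a k"
      have "cmod (z $ k / of_real (a k)) = w" using ak by (simp add: w_def norm_divide)
      then have w1: "1 - w < t" using zk norm_triangle_ineq2[of 1 "z $ k / of_real (a k)"] by simp
      have w0: "0 \<le> w" using ak by (simp add: w_def)
      have S: "(cmod (z $ j) / a j)\<^sup>2 \<le> (\<Sum>j\<in>UNIV-{k}. (cmod (z $ j) / a j)\<^sup>2)"
        using that by (intro member_le_sum) auto
      have sp: "(hnorm a z)\<^sup>2 = w\<^sup>2 + (\<Sum>j\<in>UNIV-{k}. (cmod (z $ j) / a j)\<^sup>2)"
        unfolding w_def by (rule hnorm_split)
      then have "w\<^sup>2 < 1" using z2 sum_nonneg[of "UNIV-{k}" "\<lambda>j. (cmod (z $ j) / a j)\<^sup>2"] by auto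
      then have w2: "w < 1" using w0 by (simp add: power_less_one_iff)
      have "(cmod (z $ j) / a j)\<^sup>2 < 1 - w\<^sup>2" using S sp z2 by linarith
      also have "\<dots> = (1 - w) * (1 + w)" by (simp add: power2_eq_square algebra_simps)
      also have "\<dots> \<le> t * 2" using w0 w1 w2 by (intro mult_mono) auto
      finally have "cmod (z $ j) / a j < sqrt (2 * t)"
        by (intro real_less_rsqrt) simp
      then have "cmod (z $ j) < s j" using a by (simp add: s_def field_simps)
      then show ?thesis using abs_Re_le_cmod[of "z $ j"] abs_Im_le_cmod[of "z $ j"] by auto
    qed
    then show "z \<in> box l u" using k
      by (auto simp: mem_box_complex_vec l_def u_def abs_less_iff algebra_simps) (use neg_less_iff_less in fastforce)+
  qed
  then have "emeasure lborel {z \<in> ellipsoid a. cmod (1 - hform a z (axis k (of_real (a k)))) < t} \<le> emeasure lborel (box l u)"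
    by (intro emeasure_mono) auto
  also have "\<dots> = ennreal (\<Prod>j\<in>UNIV. (Re (u $ j) - Re (l $ j)) * (Im (u $ j) - Im (l $ j)))"
    using ak t s by (intro emeasure_box_complex_vec) (auto simp: l_def u_def less_imp_le algebra_simps intro: order_trans[of _ 0])
  also have "(\<Prod>j\<in>UNIV. (Re (u $ j) - Re (l $ j)) * (Im (u $ j) - Im (l $ j))) =
      (2 * a k * t)\<^sup>2 * (\<Prod>j\<in>UNIV-{k}. (8 * (a j)\<^sup>2) * t)"
  proof -
    have "(\<Prod>j\<in>UNIV-{k}. (Re (u $ j) - Re (l $ j)) * (Im (u $ j) - Im (l $ j))) = (\<Prod>j\<in>UNIV-{k}. (8 * (a j)\<^sup>2) * t)"
      using t by (intro prod.cong refl) (auto simp: l_def u_def s_def power2_eq_square)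
    then show ?thesis
      by (subst prod.remove[of UNIV k]) (auto simp: l_def u_def power2_eq_square algebra_simps)
  qed
  also have "\<dots> = ?C * t ^ (CARD('n) + 1)"
  proof -
    have "CARD('n) = Suc (card (UNIV - {k}))" by (simp only: card_Suc_Diff1 finite UNIV_I)
    then have "CARD('n) + 1 = 2 + card (UNIV - {k})" by linarith
    then show ?thesis by (simp add: prod.distrib power_add power_mult_distrib power2_eq_square mult_ac del: card_Diff_insert card_Diff_singleton)
  qed
  finally show "emeasure lborel {z \<in> ellipsoid a. cmod (1 - hform a z (axis k (of_real (a k)))) < t} \<le> ennreal (?C * t ^ (CARD('n) + 1))" .
qed

lemma emeasure_unitary_vimage:
  assumes "\<forall>j. 0 < a j" "linear H" "\<And>z w. hform a (H z) (H w) = hform a z w" "A \<in> sets borel"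
  shows "H -` A \<in> sets borel" "emeasure lborel (H -` A) = emeasure lborel A"
proof -
  have H: "H \<in> borel_measurable borel"
    using assms(2) by (intro borel_measurable_continuous_onI linear_continuous_on linear_conv_bounded_linear[THEN iffD1])
  then show "H -` A \<in> sets borel" using measurable_sets[OF H assms(4)] by simp
  have "emeasure lborel A = emeasure (distr lborel borel H) A"
    using unitary_preserves_lborel[OF assms(1-3)] by simp
  also have "\<dots> = emeasure lborel (H -` A)"
    using H assms(4) by (subst emeasure_distr) auto
  finally show "emeasure lborel (H -` A) = emeasure lborel A" by simp
qed

lemma continuous_on_hform: "continuous_on UNIV (\<lambda>z. hform a z \<zeta>)"
  unfolding hform_def divide_inverse by (intro continuous_intros)

lemma measurable_hform [measurable]: "(\<lambda>z. hform a z \<zeta>) \<in> borel_measurable borel"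
  by (intro borel_measurable_continuous_onI continuous_on_hform)

text \<open>Form-preserving maps carry any boundary point to the model point and leave both volumes
  and the ellipsoid unchanged, so one constant serves all \<open>\<zeta>\<close>. This uniformity is
  what permits summing infinitely many kernels.\<close>

lemma cap_volume:
  fixes a :: "'n::finite \<Rightarrow> real"
  assumes a: "\<forall>j. 0 < a j"
  obtains C where "0 \<le> C" "\<And>t \<zeta>. 0 < t \<Longrightarrow> hnorm a \<zeta> = 1 \<Longrightarrow>
    emeasure lborel {z \<in> ellipsoid a. cmod (1 - hform a z \<zeta>) < t} \<le> ennreal (C * t ^ (CARD('n) + 1))"
proof -
  define k :: 'n where "k = undefined"
  define \<xi> :: "complex ^ 'n" where "\<xi> = axis k (of_real (a k))"
  obtain C where C: "0 \<le> C" "\<And>t. 0 < t \<Longrightarrow>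
    emeasure lborel {z \<in> ellipsoid a. cmod (1 - hform a z \<xi>) < t} \<le> ennreal (C * t ^ (CARD('n) + 1))"
    by (rule cap_volume_axis[OF a, of k, folded \<xi>_def]) (rule that)
  have "emeasure lborel {z \<in> ellipsoid a. cmod (1 - hform a z \<zeta>) < t} \<le> ennreal (C * t ^ (CARD('n) + 1))"
    if t: "0 < t" and \<zeta>: "hnorm a \<zeta> = 1" for t \<zeta>
  proof -
    have "hnorm a \<xi> = 1" using a hnorm_axis by (auto simp: \<xi>_def)
    then obtain H where H: "linear H" "\<And>z w. hform a (H z) (H w) = hform a z w" "H \<zeta> = \<xi>"
      using unitary_transitive[OF a \<zeta>] by blast
    have [measurable]: "ellipsoid a \<in> sets borel" using open_ellipsoid[of a] by auto
    have m: "{z \<in> ellipsoid a. cmod (1 - hform a z \<xi>) < t} \<in> sets borel" by measurable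
    have "emeasure lborel (H -` {z \<in> ellipsoid a. cmod (1 - hform a z \<xi>) < t}) \<le> ennreal (C * t ^ (CARD('n) + 1))"
      unfolding emeasure_unitary_vimage(2)[OF a H(1,2) m] by (rule C(2)[OF t])
    moreover have "H -` {z \<in> ellipsoid a. cmod (1 - hform a z \<xi>) < t} = {z \<in> ellipsoid a. cmod (1 - hform a z \<zeta>) < t}"
      using H(2)[of _ \<zeta>] by (auto simp: ellipsoid_eq unitary_hnorm[OF H(2)] H(3))
    ultimately show ?thesis by simp
  qed
  then show ?thesis using that C(1) by blast
qed

text \<open>A real part between \<open>t\<close> and \<open>2 * t\<close> makes the boxes for
  \<open>t\<close>, \<open>t / 2\<close>, \<open>t / 4\<close>, ... disjoint, while the bound on the
  imaginary part keeps \<open>Re (1 / (1 - hform a z \<xi>))\<close> of order \<open>1 / t\<close>.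
  The volume has the same order as the upper bound for the whole cap, so no exponent is
  lost.\<close>

lemma approach_boxes_axis:
  fixes a :: "'n::finite \<Rightarrow> real" and k :: 'n
  assumes a: "\<forall>j. 0 < a j"
  defines "\<xi> \<equiv> axis k (of_real (a k))"
  obtains c P where "0 < c" "\<And>t. P t \<in> sets borel"
    "\<And>t. 0 < t \<Longrightarrow> emeasure lborel (P t) = ennreal (c * t ^ (CARD('n) + 1))"
    "\<And>t z. z \<in> P t \<Longrightarrow> t < Re (1 - hform a z \<xi>) \<and> Re (1 - hform a z \<xi>) < 2 * t \<and> \<bar>Im (1 - hform a z \<xi>)\<bar> < t"
    "\<And>t z. 0 < t \<Longrightarrow> t \<le> 1/4 \<Longrightarrow> z \<in> P t \<Longrightarrow> hnorm a z < 1 \<and> (hnorm a (z - \<xi>))\<^sup>2 \<le> 6 * t"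
proof -
  have ak: "a k > 0" using a by simp
  define n where "n = real CARD('n)"
  have n: "n \<ge> 1" unfolding n_def using zero_less_card_finite[where 'a='n] by linarith
  \<comment> \<open>The divisor \<open>2 * n\<close> lets the real and imaginary parts of all
    coordinates other than \<open>k\<close> together contribute at most \<open>t\<close> to the
    square of \<open>hnorm a z\<close>.\<close>
  define s where "s t j = a j * sqrt (t / (2 * n))" for t j
  define l :: "real \<Rightarrow> complex ^ 'n" where "l t = (\<chi> j. if j = k then Complex (a k * (1 - 2 * t)) (- a k * t) else Complex (- s t j) (- s t j))" for t
  define u :: "real \<Rightarrow> complex ^ 'n" where "u t = (\<chi> j. if j = k then Complex (a k * (1 - t)) (a k * t) else Complex (s t j) (s t j))" for t
  define c where "c = 2 * (a k)\<^sup>2 * (\<Prod>j\<in>UNIV-{k}. 2 * (a j)\<^sup>2 / n)"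
  have hf: "1 - hform a z \<xi> = 1 - z $ k / of_real (a k)" for z using ak by (simp add: \<xi>_def hform_axis)
  have "0 < c" unfolding c_def using a n ak less_imp_neq[OF a[rule_format]] by (auto intro!: mult_pos_pos prod_pos divide_pos_pos)
  moreover have vol: "emeasure lborel (box (l t) (u t)) = ennreal (c * t ^ (CARD('n) + 1))" if t: "0 < t" for t
  proof -
    have s: "0 < s t j" for j using a t n by (simp add: s_def)
    have "emeasure lborel (box (l t) (u t)) = ennreal (\<Prod>j\<in>UNIV. (Re (u t $ j) - Re (l t $ j)) * (Im (u t $ j) - Im (l t $ j)))"
      using ak t s by (intro emeasure_box_complex_vec) (auto simp: l_def u_def less_imp_le algebra_simps intro: order_trans[of _ 0])
    also have "(\<Prod>j\<in>UNIV. (Re (u t $ j) - Re (l t $ j)) * (Im (u t $ j) - Im (l t $ j))) =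
        (2 * (a k)\<^sup>2 * t\<^sup>2) * (\<Prod>j\<in>UNIV-{k}. (2 * (a j)\<^sup>2 / n) * t)"
    proof -
      have sq: "sqrt (t / (2 * n)) * sqrt (t / (2 * n)) = t / (2 * n)" using t n by simp
      have "(2 * (a j * sqrt (t / (2 * n)))) * (2 * (a j * sqrt (t / (2 * n)))) = (2 * (a j)\<^sup>2 / n) * t" for j
      proof -
        have "(2 * (a j * sqrt (t / (2 * n)))) * (2 * (a j * sqrt (t / (2 * n)))) = 4 * (a j)\<^sup>2 * (sqrt (t / (2 * n)) * sqrt (t / (2 * n)))"
          by algebra
        then show ?thesis unfolding sq using n by (simp add: field_simps)
      qed
      then have "(\<Prod>j\<in>UNIV-{k}. (Re (u t $ j) - Re (l t $ j)) * (Im (u t $ j) - Im (l t $ j))) = (\<Prod>j\<in>UNIV-{k}. (2 * (a j)\<^sup>2 / n) * t)"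
        by (intro prod.cong refl) (auto simp: l_def u_def s_def)
      then show ?thesis
        by (subst prod.remove[of UNIV k]) (auto simp: l_def u_def power2_eq_square algebra_simps)
    qed
    also have "\<dots> = c * t ^ (CARD('n) + 1)"
    proof -
      have "CARD('n) = Suc (card (UNIV - {k}))" by (simp only: card_Suc_Diff1 finite UNIV_I)
    then have "CARD('n) + 1 = 2 + card (UNIV - {k})" by linarith
      then show ?thesis unfolding c_def prod.distrib prod_constant by (simp only: power_add mult_ac)
    qed
    finally show ?thesis .
  qed
  moreover have loc: "t < Re (1 - hform a z \<xi>) \<and> Re (1 - hform a z \<xi>) < 2 * t \<and> \<bar>Im (1 - hform a z \<xi>)\<bar> < t"
    if z: "z \<in> box (l t) (u t)" for t z
  proof -
    have "a k * (1 - 2 * t) < Re (z $ k)" "Re (z $ k) < a k * (1 - t)" "- a k * t < Im (z $ k)" "Im (z $ k) < a k * t"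
      using z unfolding mem_box_complex_vec l_def u_def by (auto dest!: spec[of _ k])
    then show ?thesis using ak unfolding hf
      by (simp add: Re_divide_of_real Im_divide_of_real field_simps abs_less_iff)
  qed
  moreover have "hnorm a z < 1 \<and> (hnorm a (z - \<xi>))\<^sup>2 \<le> 6 * t" if t: "0 < t" "t \<le> 1/4" and z: "z \<in> box (l t) (u t)" for t z
  proof -
    define x where "x = Re (1 - hform a z \<xi>)"
    define y where "y = Im (1 - hform a z \<xi>)"
    have xy: "t < x" "x < 2 * t" "\<bar>y\<bar> < t" using loc[OF z] by (auto simp: x_def y_def)
    have zk: "z $ k / of_real (a k) = Complex (1 - x) (- y)"
      using hf[of z] by (simp add: x_def y_def complex_eq_iff)
    have y2: "y\<^sup>2 \<le> t\<^sup>2" using xy by (simp add: abs_le_square_iff[symmetric])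
    have x2: "x\<^sup>2 \<le> (2*t)\<^sup>2" using xy t by (intro power_mono) auto
    have rest: "(\<Sum>j\<in>UNIV-{k}. (cmod (z $ j) / a j)\<^sup>2) \<le> t"
    proof -
      have "(cmod (z $ j) / a j)\<^sup>2 \<le> t / n" if "j \<noteq> k" for j
      proof -
        have aj: "a j > 0" using a by simp
        have "\<bar>Re (z $ j)\<bar> < s t j" "\<bar>Im (z $ j)\<bar> < s t j"
          using z that unfolding mem_box_complex_vec l_def u_def by (auto dest!: spec[of _ j])
        then have "(Re (z $ j))\<^sup>2 \<le> (s t j)\<^sup>2" "(Im (z $ j))\<^sup>2 \<le> (s t j)\<^sup>2"
          by (simp_all add: abs_le_square_iff[symmetric])
        then have "(cmod (z $ j))\<^sup>2 \<le> 2 * (s t j)\<^sup>2" by (simp add: cmod_power2)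
        also have "2 * (s t j)\<^sup>2 = (a j)\<^sup>2 * (t / n)"
          using t n by (simp add: s_def power_mult_distrib)
        finally show ?thesis using aj by (simp add: power_divide field_simps)
      qed
      then have "(\<Sum>j\<in>UNIV-{k}. (cmod (z $ j) / a j)\<^sup>2) \<le> (\<Sum>j\<in>UNIV-{k}. t / n)"
        by (intro sum_mono) auto
      also have "\<dots> \<le> (\<Sum>j\<in>(UNIV::'n set). t / n)" using t n by (intro sum_mono2) auto
      also have "\<dots> = t" using n by (simp add: n_def)
      finally show ?thesis .
    qed
    have "(cmod (z $ k) / a k)\<^sup>2 = (cmod (z $ k / of_real (a k)))\<^sup>2" using ak by (simp add: norm_divide)
    also have "\<dots> = (1 - x)\<^sup>2 + y\<^sup>2" unfolding zk by (simp add: cmod_power2)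
    also have "(1 - x)\<^sup>2 \<le> (1 - t)\<^sup>2" using xy t by (intro power_mono) auto
    finally have "(hnorm a z)\<^sup>2 \<le> (1 - t)\<^sup>2 + t\<^sup>2 + t" using hnorm_split[of a z k] y2 rest by linarith
    \<comment> \<open>Moving inward by \<open>t\<close> gains \<open>2 * t\<close> to first order,
      and the other coordinates cost \<open>t\<close>. The bound \<open>t \<le> 1/4\<close> keeps
      the remaining gain positive.\<close>
    also have "\<dots> = 1 - t * (1 - 2 * t)" by (simp add: power2_eq_square algebra_simps)
    also have "\<dots> < 1" using t by simp
    finally have 1: "hnorm a z < 1" by (simp add: power_less_one_iff)
    have "(cmod ((z - \<xi>) $ k) / a k)\<^sup>2 = (cmod ((z - \<xi>) $ k / of_real (a k)))\<^sup>2" using ak by (simp add: norm_divide)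
    also have "(z - \<xi>) $ k / of_real (a k) = Complex (- x) (- y)"
      using ak zk by (simp add: \<xi>_def diff_divide_distrib complex_eq_iff)
    also have "(cmod (Complex (- x) (- y)))\<^sup>2 = x\<^sup>2 + y\<^sup>2" by (simp add: cmod_power2)
    finally have k2: "(cmod ((z - \<xi>) $ k) / a k)\<^sup>2 \<le> 5 * t\<^sup>2" using x2 y2 by (simp add: power_mult_distrib)
    have "(\<Sum>j\<in>UNIV-{k}. (cmod ((z - \<xi>) $ j) / a j)\<^sup>2) = (\<Sum>j\<in>UNIV-{k}. (cmod (z $ j) / a j)\<^sup>2)"
      by (intro sum.cong) (auto simp: \<xi>_def axis_def)
    \<comment> \<open>The coordinate \<open>k\<close> contributes
      \<open>x^2 + y^2 <= 4 * t^2 + t^2\<close> and the others at most \<open>t\<close>; with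
      \<open>t^2 <= t\<close> this is the constant 6.\<close>
    then have "(hnorm a (z - \<xi>))\<^sup>2 \<le> 5 * t\<^sup>2 + t" using hnorm_split[of a "z - \<xi>" k] k2 rest by linarith
    also have "t\<^sup>2 \<le> t" using t by (simp add: power2_eq_square)
    finally show ?thesis using 1 by simp
  qed
  ultimately show ?thesis using that[of c "\<lambda>t. box (l t) (u t)"] by auto
qed

text \<open>The boxes at the model point are pulled back along a form-preserving map. The preimages
  need not be boxes, so only measurability, volume and the estimates are recorded.\<close>

lemma approach_sets:
  fixes a :: "'n::finite \<Rightarrow> real"
  assumes a: "\<forall>j. 0 < a j" and \<zeta>: "hnorm a \<zeta> = 1"
  obtains c P where "0 < c" "\<And>t. P t \<in> sets borel"
    "\<And>t. 0 < t \<Longrightarrow> emeasure lborel (P t) = ennreal (c * t ^ (CARD('n) + 1))"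
    "\<And>t z. z \<in> P t \<Longrightarrow> t < Re (1 - hform a z \<zeta>) \<and> Re (1 - hform a z \<zeta>) < 2 * t \<and> \<bar>Im (1 - hform a z \<zeta>)\<bar> < t"
    "\<And>t z. 0 < t \<Longrightarrow> t \<le> 1/4 \<Longrightarrow> z \<in> P t \<Longrightarrow> hnorm a z < 1 \<and> (hnorm a (z - \<zeta>))\<^sup>2 \<le> 6 * t"
proof -
  define k :: 'n where "k = undefined"
  define \<xi> :: "complex ^ 'n" where "\<xi> = axis k (of_real (a k))"
  obtain c P where c: "0 < c" and P: "\<And>t. P t \<in> sets borel"
    "\<And>t. 0 < t \<Longrightarrow> emeasure lborel (P t) = ennreal (c * t ^ (CARD('n) + 1))"
    "\<And>t z. z \<in> P t \<Longrightarrow> t < Re (1 - hform a z \<xi>) \<and> Re (1 - hform a z \<xi>) < 2 * t \<and> \<bar>Im (1 - hform a z \<xi>)\<bar> < t"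
    "\<And>t z. 0 < t \<Longrightarrow> t \<le> 1/4 \<Longrightarrow> z \<in> P t \<Longrightarrow> hnorm a z < 1 \<and> (hnorm a (z - \<xi>))\<^sup>2 \<le> 6 * t"
    by (rule approach_boxes_axis[OF a, of k, folded \<xi>_def]) (rule that)
  have "hnorm a \<xi> = 1" using a hnorm_axis by (auto simp: \<xi>_def)
  then obtain H where H: "linear H" "\<And>z w. hform a (H z) (H w) = hform a z w" "H \<zeta> = \<xi>"
    using unitary_transitive[OF a \<zeta>] by blast
  have 1: "hform a (H z) \<xi> = hform a z \<zeta>" for z using H(2)[of z \<zeta>] H(3) by simp
  have 2: "hnorm a (H z - \<xi>) = hnorm a (z - \<zeta>)" for z
    using unitary_hnorm[OF H(2), of "z - \<zeta>"] by (simp add: linear_diff[OF H(1)] H(3))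
  show ?thesis
  proof (rule that[of c "\<lambda>t. H -` P t"])
    show "H -` P t \<in> sets borel" for t using emeasure_unitary_vimage[OF a H(1,2) P(1)] by blast
    show "emeasure lborel (H -` P t) = ennreal (c * t ^ (CARD('n) + 1))" if "0 < t" for t
      using emeasure_unitary_vimage(2)[OF a H(1,2) P(1)] P(2)[OF that] by simp
    show "t < Re (1 - hform a z \<zeta>) \<and> Re (1 - hform a z \<zeta>) < 2 * t \<and> \<bar>Im (1 - hform a z \<zeta>)\<bar> < t" if "z \<in> H -` P t" for t z
      using P(3)[of "H z" t] that 1 by simp
    show "hnorm a z < 1 \<and> (hnorm a (z - \<zeta>))\<^sup>2 \<le> 6 * t" if "0 < t" "t \<le> 1/4" "z \<in> H -` P t" for t z
      using P(4)[of t "H z"] that 2 unitary_hnorm[OF H(2)] by simp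
  qed (rule c)
qed

subsection \<open>The kernel\<close>

text \<open>With \<open>w = hform a z \<zeta>\<close> this is \<open>1 + (1 + w) / (1 - w)\<close>.
  The fraction maps the unit disc to the right half plane, so the numerator 2 yields the lower bound
  1 for the real part.\<close>

definition ckernel :: "('n::finite \<Rightarrow> real) \<Rightarrow> complex ^ 'n \<Rightarrow> complex ^ 'n \<Rightarrow> complex" where
  "ckernel a \<zeta> z = 2 / (1 - hform a z \<zeta>)"

lemma norm_hform_less_1:
  assumes "hnorm a \<zeta> = 1" "z \<in> ellipsoid a"
  shows "cmod (hform a z \<zeta>) < 1"
  using hform_le[of a z \<zeta>] assms by (simp add: ellipsoid_eq)

lemma hform_neq_1: "hnorm a \<zeta> = 1 \<Longrightarrow> z \<in> ellipsoid a \<Longrightarrow> hform a z \<zeta> \<noteq> 1"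
  using norm_hform_less_1 by fastforce

lemma Re_ckernel_ge_1:
  assumes "hnorm a \<zeta> = 1" "z \<in> ellipsoid a"
  shows "1 \<le> Re (ckernel a \<zeta> z)"
proof -
  define w where "w = hform a z \<zeta>"
  have w: "cmod w < 1" using norm_hform_less_1[OF assms] by (simp add: w_def)
  then have "(cmod w)\<^sup>2 < 1" by (simp add: power_less_one_iff)
  then have "(Re w)\<^sup>2 + (Im w)\<^sup>2 < 1" by (simp add: cmod_power2)
  then have "(1 - Re w)\<^sup>2 + (Im w)\<^sup>2 \<le> 2 * (1 - Re w)" by (simp add: power2_eq_square algebra_simps)
  moreover have "0 < (1 - Re w)\<^sup>2 + (Im w)\<^sup>2"
  proof -
    have "Re w < 1" using w complex_Re_le_cmod[of w] by linarith
    then show ?thesis by (intro add_pos_nonneg) auto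
  qed
  ultimately show ?thesis by (simp add: ckernel_def w_def[symmetric] Re_divide field_simps)
qed

lemma has_derivative_hform: "((\<lambda>z. hform a z \<zeta>) has_derivative (\<lambda>v. hform a v \<zeta>)) (at z)"
proof -
  have "linear (\<lambda>z. hform a z \<zeta>)"
  proof
    fix x y :: "complex ^ 'a" and c :: real
    show "hform a (x + y) \<zeta> = hform a x \<zeta> + hform a y \<zeta>" by (rule hform_add_left)
    show "hform a (c *\<^sub>R x) \<zeta> = c *\<^sub>R hform a x \<zeta>"
      by (simp add: hform_def scaleR_sum_right scaleR_conv_of_real[where x = "x $ _"]) (simp add: scaleR_conv_of_real mult.assoc)
  qed
  then show ?thesis
    by (intro bounded_linear_imp_has_derivative linear_conv_bounded_linear[THEN iffD1])
qed

lemma has_derivative_ckernel: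
  assumes "hnorm a \<zeta> = 1" "z \<in> ellipsoid a"
  shows "(ckernel a \<zeta> has_derivative (\<lambda>v. 2 * hform a v \<zeta> / (1 - hform a z \<zeta>)\<^sup>2)) (at z)"
proof -
  have "((\<lambda>w. 2 / (1 - w)) has_field_derivative 2 / (1 - hform a z \<zeta>)\<^sup>2) (at (hform a z \<zeta>))"
    using hform_neq_1[OF assms] by (auto intro!: derivative_eq_intros simp: power2_eq_square)
  then have "((\<lambda>w. 2 / (1 - w)) has_derivative (\<lambda>v. 2 / (1 - hform a z \<zeta>)\<^sup>2 * v)) (at (hform a z \<zeta>))"
    by (simp only: has_field_derivative_def)
  from has_derivative_compose[OF has_derivative_hform this]
  show ?thesis unfolding ckernel_def by simp
qed

lemma continuous_on_ckernel: "hnorm a \<zeta> = 1 \<Longrightarrow> continuous_on (ellipsoid a) (ckernel a \<zeta>)"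
  by (meson continuous_at_imp_continuous_on has_derivative_ckernel has_derivative_continuous)

text \<open>Uniformity in \<open>\<zeta>\<close> on smaller ellipsoids provides the majorants for
  the series of kernels and of their derivatives.\<close>

lemma norm_ckernel_le:
  assumes "hnorm a \<zeta> = 1" "hnorm a z < \<rho>" "\<rho> < 1"
  shows "cmod (ckernel a \<zeta> z) \<le> 2 / (1 - \<rho>)" "1 - \<rho> \<le> cmod (1 - hform a z \<zeta>)"
proof -
  have "cmod (hform a z \<zeta>) \<le> \<rho>" using hform_le[of a z \<zeta>] assms by simp
  then show *: "1 - \<rho> \<le> cmod (1 - hform a z \<zeta>)" using norm_triangle_ineq2[of 1 "hform a z \<zeta>"] by simp
  show "cmod (ckernel a \<zeta> z) \<le> 2 / (1 - \<rho>)"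
    unfolding ckernel_def norm_divide using * assms by (auto intro!: divide_left_mono mult_pos_pos)
qed

lemma dyadic_scale:
  fixes y :: real
  assumes "0 < y" "y < 2"
  obtains m :: nat where "(1/2) ^ m \<le> y" "y < 2 * (1/2) ^ m"
proof -
  define m where "m = (LEAST m. (1/2::real) ^ m \<le> y)"
  have "\<exists>m. (1/2::real) ^ m \<le> y" 
    using real_arch_pow_inv[of y "1/2"] assms by (auto intro: less_imp_le)
  then have 1: "(1/2::real) ^ m \<le> y" unfolding m_def by (rule LeastI_ex)
  have "y < 2 * (1/2) ^ m"
  proof (cases m)
    case 0 then show ?thesis using assms by simp
  next
    case (Suc k)
    then have "\<not> (1/2::real) ^ k \<le> y" unfolding m_def using not_less_Least[of k "\<lambda>m. (1/2::real) ^ m \<le> y"] by simp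
    then show ?thesis using Suc by simp
  qed
  then show ?thesis using that 1 by blast
qed

text \<open>Dyadic decomposition: where \<open>|1 - hform a z \<zeta>|\<close> is about
  \<open>2^-m\<close>, the kernel is at most \<open>2 * 2^m\<close> and the cap has volume
  \<open>O(2^(-m * (n + 1)))\<close>. The resulting geometric series has ratio
  \<open>2^(r - (n + 1))\<close>, below 1 exactly because \<open>r < n + 1\<close>.\<close>

lemma ckernel_integrable:
  fixes a :: "'n::finite \<Rightarrow> real" and r :: real
  assumes a: "\<forall>j. 0 < a j" and r: "0 < r" "r < real CARD('n) + 1"
  obtains M where "0 \<le> M" "\<And>\<zeta>. hnorm a \<zeta> = 1 \<Longrightarrow> Lpint r (ellipsoid a) (ckernel a \<zeta>) \<le> ennreal M"
proof -
  obtain C where C: "0 \<le> C" "\<And>t \<zeta>. 0 < t \<Longrightarrow> hnorm a \<zeta> = 1 \<Longrightarrow>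
    emeasure lborel {z \<in> ellipsoid a. cmod (1 - hform a z \<zeta>) < t} \<le> ennreal (C * t ^ (CARD('n) + 1))"
    by (rule cap_volume[OF a]) (rule that)
  define f where "f m = (2 * 2 ^ m) powr r * (C * (2 * (1/2) ^ m) ^ (CARD('n) + 1))" for m :: nat
  have f0: "0 \<le> f m" for m using C(1) by (simp add: f_def)
  have feq: "f m = (2 powr r * C * 2 ^ (CARD('n) + 1)) * (2 powr (r - (real CARD('n) + 1))) ^ m" for m
  proof -
    have "(2 * 2 ^ m) powr r = 2 powr r * (2 powr r) ^ m"
      by (simp add: powr_mult powr_powr powr_realpow[symmetric] mult.commute)
    moreover have "(2 * (1/2::real) ^ m) ^ (CARD('n) + 1) = 2 ^ (CARD('n) + 1) * ((1/2) ^ (CARD('n) + 1)) ^ m"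
      by (simp only: power_mult_distrib power_mult[symmetric] mult.commute)
    moreover have "(2 powr (r - (real CARD('n) + 1))) = 2 powr r * (1/2) ^ (CARD('n) + 1)"
      using powr_realpow[of 2 "CARD('n) + 1"] by (simp add: powr_diff power_one_over add.commute)
    ultimately show ?thesis unfolding f_def by (simp only: power_mult_distrib mult_ac)
  qed
  have "2 powr (r - (real CARD('n) + 1)) < 2 powr 0" using r by (intro powr_less_mono) auto
  then have sf: "summable f" unfolding feq by (intro summable_mult summable_geometric) auto
  have "Lpint r (ellipsoid a) (ckernel a \<zeta>) \<le> ennreal (suminf f)" if \<zeta>: "hnorm a \<zeta> = 1" for \<zeta>
  proof -
    \<comment> \<open>Full caps rather than shells: a point may be counted several times, which is
      harmless in an upper bound.\<close>
    define K where "K m = {z \<in> ellipsoid a. cmod (1 - hform a z \<zeta>) < 2 * (1/2) ^ m}" for m :: nat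
    have [measurable]: "ellipsoid a \<in> sets borel" using open_ellipsoid[of a] by auto
    have [measurable]: "K m \<in> sets borel" for m unfolding K_def by measurable
    have "Lpint r (ellipsoid a) (ckernel a \<zeta>) \<le> (\<integral>\<^sup>+ z. (\<Sum>m. ennreal ((2 * 2 ^ m) powr r) * indicator (K m) z) \<partial>lborel)"
    proof (rule nn_integral_mono)
      fix z
      show "indicator (ellipsoid a) z * ennreal (norm (ckernel a \<zeta> z) powr r) \<le> (\<Sum>m. ennreal ((2 * 2 ^ m) powr r) * indicator (K m) z)"
      proof (cases "z \<in> ellipsoid a")
        case True
        define y where "y = cmod (1 - hform a z \<zeta>)"
        have "y \<le> 1 + cmod (hform a z \<zeta>)" using norm_triangle_ineq4[of 1 "hform a z \<zeta>"] by (simp add: y_def)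
        then have "y < 2" using norm_hform_less_1[OF \<zeta> True] by simp
        moreover have "y > 0" using hform_neq_1[OF \<zeta> True] by (simp add: y_def)
        ultimately obtain m where m: "(1/2) ^ m \<le> y" "y < 2 * (1/2) ^ m" using dyadic_scale by blast
        have "norm (ckernel a \<zeta> z) = 2 / y" by (simp add: ckernel_def norm_divide y_def)
        also have "\<dots> \<le> 2 / (1/2) ^ m" using m \<open>y > 0\<close> by (intro divide_left_mono) auto
        also have "\<dots> = 2 * 2 ^ m" by (simp add: power_one_over)
        finally have "norm (ckernel a \<zeta> z) powr r \<le> (2 * 2 ^ m) powr r" using r by (intro powr_mono2) auto
        then have "indicator (ellipsoid a) z * ennreal (norm (ckernel a \<zeta> z) powr r) \<le> ennreal ((2 * 2 ^ m) powr r) * indicator (K m) z"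
          using True m by (auto simp: K_def y_def intro!: ennreal_leI)
        also have "\<dots> \<le> (\<Sum>m. ennreal ((2 * 2 ^ m) powr r) * indicator (K m) z)"
        proof -
          have "g m \<le> suminf g" for g :: "nat \<Rightarrow> ennreal"
            using sum_le_suminf[OF summableI, of "{m}" g] by simp
          then show ?thesis .
        qed
        finally show ?thesis .
      qed auto
    qed
    also have "\<dots> = (\<Sum>m. ennreal ((2 * 2 ^ m) powr r) * emeasure lborel (K m))"
      by (subst nn_integral_suminf) (auto simp: nn_integral_cmult)
    also have "\<dots> \<le> (\<Sum>m. ennreal (f m))"
    proof (intro suminf_le summableI)
      fix m
      have "ennreal ((2 * 2 ^ m) powr r) * emeasure lborel (K m) \<le> ennreal ((2 * 2 ^ m) powr r) * ennreal (C * (2 * (1/2) ^ m) ^ (CARD('n) + 1))"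
        unfolding K_def by (intro mult_left_mono C \<zeta>) auto
      also have "\<dots> = ennreal (f m)" unfolding f_def using C(1) by (subst ennreal_mult) auto
      finally show "ennreal ((2 * 2 ^ m) powr r) * emeasure lborel (K m) \<le> ennreal (f m)" .
    qed
    also have "\<dots> = ennreal (suminf f)" using f0 sf by (intro suminf_ennreal2) auto
    finally show ?thesis .
  qed
  moreover have "0 \<le> suminf f" using sf f0 by (rule suminf_nonneg)
  ultimately show ?thesis using that by blast
qed

text \<open>Infinitely many disjoint sets shrinking to \<open>\<zeta>\<close> each contribute at
  least a fixed positive amount. The real part is used, not the modulus, because real parts can be
  compared with the real part of the whole sum later.\<close>

lemma Re_ckernel_not_integrable:
  fixes a :: "'n::finite \<Rightarrow> real"
  assumes a: "\<forall>j. 0 < a j" and \<zeta>: "hnorm a \<zeta> = 1" and \<rho>: "0 < \<rho>"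
  shows "(\<integral>\<^sup>+ z. indicator {z \<in> ellipsoid a. hnorm a (z - \<zeta>) < \<rho>} z * ennreal (Re (ckernel a \<zeta> z) ^ (CARD('n) + 1)) \<partial>lborel) = \<infinity>"
proof -
  obtain c P where c: "0 < c" and P: "\<And>t. P t \<in> sets borel"
    "\<And>t. 0 < t \<Longrightarrow> emeasure lborel (P t) = ennreal (c * t ^ (CARD('n) + 1))"
    "\<And>t z. z \<in> P t \<Longrightarrow> t < Re (1 - hform a z \<zeta>) \<and> Re (1 - hform a z \<zeta>) < 2 * t \<and> \<bar>Im (1 - hform a z \<zeta>)\<bar> < t"
    "\<And>t z. 0 < t \<Longrightarrow> t \<le> 1/4 \<Longrightarrow> z \<in> P t \<Longrightarrow> hnorm a z < 1 \<and> (hnorm a (z - \<zeta>))\<^sup>2 \<le> 6 * t"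
    by (rule approach_sets[OF a \<zeta>]) (rule that)
  \<comment> \<open>Scales below \<open>1/4\<close> keep the sets inside the ellipsoid, and
    \<open>6 * \<tau> < \<rho>^2\<close> keeps them within \<open>\<rho>\<close> of
    \<open>\<zeta>\<close>.\<close>
  obtain m0 where "(1/2::real) ^ m0 < min (1/4) (\<rho>\<^sup>2 / 6)" using real_arch_pow_inv[of "min (1/4) (\<rho>\<^sup>2 / 6)" "1/2"] \<rho> by auto
  then have m0: "(1/2::real) ^ m0 < 1/4" "6 * (1/2::real) ^ m0 < \<rho>\<^sup>2" by auto
  define \<tau> where "\<tau> m = (1/2::real) ^ (m + m0)" for m
  have \<tau>: "0 < \<tau> m" "\<tau> m \<le> 1/4" "6 * \<tau> m < \<rho>\<^sup>2" for m
  proof -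
    have "(1/2::real) ^ (m + m0) \<le> (1/2) ^ m0" by (intro power_decreasing) auto
    then show "\<tau> m \<le> 1/4" "6 * \<tau> m < \<rho>\<^sup>2" unfolding \<tau>_def using m0 by linarith+
  qed (simp add: \<tau>_def)
  define U where "U = {z \<in> ellipsoid a. hnorm a (z - \<zeta>) < \<rho>}"
  define F where "F z = indicator U z * ennreal (Re (ckernel a \<zeta> z) ^ (CARD('n) + 1))" for z
  have [measurable]: "ellipsoid a \<in> sets borel" using open_ellipsoid[of a] by auto
  have [measurable]: "U \<in> sets borel" unfolding U_def by measurable
  have [measurable]: "ckernel a \<zeta> \<in> borel_measurable borel" unfolding ckernel_def by measurable
  have Fm [measurable]: "F \<in> borel_measurable lborel" unfolding F_def by measurable
  have Psub: "P (\<tau> m) \<subseteq> U" for m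
  proof
    fix z assume "z \<in> P (\<tau> m)"
    then have "hnorm a z < 1" "(hnorm a (z - \<zeta>))\<^sup>2 \<le> 6 * \<tau> m" using P(4)[OF \<tau>(1,2)] by blast+
    moreover then have "hnorm a (z - \<zeta>) < \<rho>" using \<tau>(3)[of m] \<rho> by (meson le_less_trans less_imp_le power2_less_imp_less)
    ultimately show "z \<in> U" by (simp add: U_def ellipsoid_eq)
  qed
  have "disjoint_family (\<lambda>m. P (\<tau> m))"
  proof -
    have "P (\<tau> m) \<inter> P (\<tau> k) = {}" if "m < k" for m k
    proof -
      have "\<tau> k \<le> \<tau> (Suc m)" unfolding \<tau>_def using that by (intro power_decreasing) auto
      also have "2 * \<tau> (Suc m) = \<tau> m" by (simp add: \<tau>_def)
      finally have "2 * \<tau> k \<le> \<tau> m" by simp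
      then show ?thesis using P(3)[of _ "\<tau> m"] P(3)[of _ "\<tau> k"] by force
    qed
    then show ?thesis unfolding disjoint_family_on_def by (metis Int_commute nat_neq_iff)
  qed
  then have sm: "(\<Sum>m. emeasure (density lborel F) (P (\<tau> m))) = emeasure (density lborel F) (\<Union>m. P (\<tau> m))"
    using P(1) by (intro suminf_emeasure) auto
  \<comment> \<open>On the set of scale \<open>\<tau> m\<close> the real part is at least
    \<open>2 / (5 * \<tau> m)\<close>, from \<open>x > \<tau> m\<close> and
    \<open>x^2 + y^2 <= 5 * (\<tau> m)^2\<close>. The powers of \<open>\<tau> m\<close> cancel
    against the volume and leave \<open>d\<close>.\<close>
  define d where "d = c * (2/5) ^ (CARD('n) + 1)"
  have d: "d > 0" using c by (simp add: d_def)
  have low: "ennreal d \<le> emeasure (density lborel F) (P (\<tau> m))" for m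
  proof -
    have "ennreal d = ennreal ((2 / (5 * \<tau> m)) ^ (CARD('n) + 1)) * emeasure lborel (P (\<tau> m))"
    proof -
      have "d = (2 / (5 * \<tau> m)) ^ (CARD('n) + 1) * (c * \<tau> m ^ (CARD('n) + 1))"
        unfolding d_def using \<tau>(1)[of m] by (simp add: power_divide power_mult_distrib)
      then show ?thesis using P(2)[OF \<tau>(1)] \<tau>(1)[of m] c
        by (simp add: ennreal_mult[symmetric] less_imp_le del: power_Suc power_add)
    qed
    also have "\<dots> = (\<integral>\<^sup>+ z. ennreal ((2 / (5 * \<tau> m)) ^ (CARD('n) + 1)) * indicator (P (\<tau> m)) z \<partial>lborel)"
      using P(1) by (subst nn_integral_cmult) auto
    also have "\<dots> \<le> (\<integral>\<^sup>+ z. F z * indicator (P (\<tau> m)) z \<partial>lborel)"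
    proof (intro nn_integral_mono)
      fix z
      show "ennreal ((2 / (5 * \<tau> m)) ^ (CARD('n) + 1)) * indicator (P (\<tau> m)) z \<le> F z * indicator (P (\<tau> m)) z"
      proof (cases "z \<in> P (\<tau> m)")
        case True
        define x where "x = Re (1 - hform a z \<zeta>)"
        define y where "y = Im (1 - hform a z \<zeta>)"
        have xy: "\<tau> m < x" "x < 2 * \<tau> m" "\<bar>y\<bar> < \<tau> m" using P(3)[OF True] by (auto simp: x_def y_def)
        have "y\<^sup>2 \<le> (\<tau> m)\<^sup>2" using xy by (simp add: abs_le_square_iff[symmetric])
        moreover have "x\<^sup>2 \<le> (2 * \<tau> m)\<^sup>2" using xy \<tau>(1)[of m] by (intro power_mono) auto
        ultimately have b: "x\<^sup>2 + y\<^sup>2 \<le> 5 * (\<tau> m)\<^sup>2" by (simp add: power_mult_distrib)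
        have p: "0 < x\<^sup>2 + y\<^sup>2" using xy \<tau>(1)[of m] by (intro add_pos_nonneg) auto
        have "2 / (5 * \<tau> m) = 2 * \<tau> m / (5 * (\<tau> m)\<^sup>2)" using \<tau>(1)[of m] by (simp add: power2_eq_square)
        also have "\<dots> \<le> 2 * x / (x\<^sup>2 + y\<^sup>2)" using b p xy \<tau>(1)[of m] by (intro frac_le) auto
        also have "\<dots> = Re (ckernel a \<zeta> z)" by (simp add: ckernel_def Re_divide x_def y_def)
        finally have "(2 / (5 * \<tau> m)) ^ (CARD('n) + 1) \<le> Re (ckernel a \<zeta> z) ^ (CARD('n) + 1)"
          using \<tau>(1)[of m] by (intro power_mono) auto
        then show ?thesis using True Psub[of m] by (auto simp: F_def intro!: ennreal_leI)
      qed auto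
    qed
    also have "\<dots> = emeasure (density lborel F) (P (\<tau> m))"
      using P(1) by (subst emeasure_density) auto
    finally show ?thesis .
  qed
  have "(\<Sum>m. emeasure (density lborel F) (P (\<tau> m))) = \<infinity>"
  proof -
    have "of_nat N * ennreal d \<le> (\<Sum>m. emeasure (density lborel F) (P (\<tau> m)))" for N :: nat
    proof -
      have "of_nat N * ennreal d = (\<Sum>m<N. ennreal d)" by simp
      also have "\<dots> \<le> (\<Sum>m<N. emeasure (density lborel F) (P (\<tau> m)))" by (intro sum_mono low)
      also have "\<dots> \<le> (\<Sum>m. emeasure (density lborel F) (P (\<tau> m)))" by (intro sum_le_suminf summableI) auto
      finally show ?thesis .
    qed
    then have le: "ennreal (N * d) \<le> (\<Sum>m. emeasure (density lborel F) (P (\<tau> m)))" for N :: nat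
      using d by (simp add: ennreal_mult ennreal_of_nat_eq_real_of_nat)
    show ?thesis
    proof (rule ccontr)
      assume "(\<Sum>m. emeasure (density lborel F) (P (\<tau> m))) \<noteq> \<infinity>"
      then obtain v where v: "(\<Sum>m. emeasure (density lborel F) (P (\<tau> m))) = ennreal v" "v \<ge> 0"
        by (metis ennreal_cases infinity_ennreal_def)
      obtain N :: nat where "v < N * d" using d reals_Archimedean3 by blast
      then show False using le[of N] v by (simp add: ennreal_le_iff)
    qed
  qed
  then have "\<infinity> = emeasure (density lborel F) (\<Union>m. P (\<tau> m))" using sm by simp
  also have "\<dots> \<le> emeasure (density lborel F) UNIV" by (intro emeasure_mono) auto
  also have "\<dots> = (\<integral>\<^sup>+ z. F z \<partial>lborel)" by (subst emeasure_density) auto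
  finally show ?thesis unfolding F_def U_def by (simp add: top_unique)
qed

subsection \<open>The sum of kernels\<close>

definition csum :: "('n::finite \<Rightarrow> real) \<Rightarrow> (nat \<Rightarrow> complex ^ 'n) \<Rightarrow> complex ^ 'n \<Rightarrow> complex" where
  "csum a \<zeta> z = (\<Sum>i. (1/2) ^ Suc i * ckernel a (\<zeta> i) z)"

lemma norm_half_power: "cmod ((1/2) ^ i) = (1/2) ^ i"
  by (simp add: norm_power)

lemma summable_csum:
  assumes \<zeta>: "\<And>i. hnorm a (\<zeta> i) = 1" and z: "z \<in> ellipsoid a"
  shows "summable (\<lambda>i. (1/2) ^ Suc i * ckernel a (\<zeta> i) z)"
proof -
  define \<rho> where "\<rho> = (1 + hnorm a z) / 2"
  have \<rho>: "hnorm a z < \<rho>" "\<rho> < 1" using z by (auto simp: \<rho>_def ellipsoid_eq)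
  have "summable (\<lambda>i. (1/2::real) ^ Suc i * (2 / (1 - \<rho>)))"
    using half_Suc_sums by (intro summable_mult2) (auto simp: sums_iff)
  then show ?thesis
  proof (rule summable_comparison_test'[where N = 0])
    fix i :: nat
    show "cmod ((1/2) ^ Suc i * ckernel a (\<zeta> i) z) \<le> (1/2) ^ Suc i * (2 / (1 - \<rho>))"
      unfolding norm_mult norm_half_power by (intro mult_left_mono norm_ckernel_le \<zeta> \<rho>) auto
  qed
qed

lemma csum_sums:
  assumes \<zeta>: "\<And>i. hnorm a (\<zeta> i) = 1" and z: "z \<in> ellipsoid a"
  shows "(\<lambda>i. (1/2) ^ Suc i * ckernel a (\<zeta> i) z) sums csum a \<zeta> z"
  unfolding csum_def using summable_csum[OF assms] by (rule summable_sums)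

lemma Re_csum_sums:
  assumes \<zeta>: "\<And>i. hnorm a (\<zeta> i) = 1" and z: "z \<in> ellipsoid a"
  shows "(\<lambda>i. (1/2) ^ Suc i * Re (ckernel a (\<zeta> i) z)) sums Re (csum a \<zeta> z)"
proof -
  have "Re ((1/2) ^ k * w) = (1/2) ^ k * Re w" for k :: nat and w :: complex
  proof -
    have "(1/2::complex) ^ k = of_real ((1/2) ^ k)" by simp
    then show ?thesis by (simp only: times_complex.simps Re_complex_of_real Im_complex_of_real mult_zero_left diff_zero)
  qed
  then show ?thesis using sums_Re[OF csum_sums[OF assms]] by (simp del: power_Suc)
qed

text \<open>The weights sum to 1, so the bound 1 for the real part of each kernel passes to the sum.
  All real parts are nonnegative, so discarding every term but one gives the second bound.\<close>

lemma Re_csum_ge: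
  assumes \<zeta>: "\<And>i. hnorm a (\<zeta> i) = 1" and z: "z \<in> ellipsoid a"
  shows "1 \<le> Re (csum a \<zeta> z)" "(1/2) ^ Suc i * Re (ckernel a (\<zeta> i) z) \<le> Re (csum a \<zeta> z)"
proof -
  have R: "1 \<le> Re (ckernel a (\<zeta> i) z)" for i using Re_ckernel_ge_1[OF \<zeta> z] .
  have "(1/2) ^ Suc i \<le> (1/2) ^ Suc i * Re (ckernel a (\<zeta> i) z)" for i
    using R[of i] mult_left_mono[of 1 "Re (ckernel a (\<zeta> i) z)" "(1/2) ^ Suc i"] by (simp del: power_Suc)
  then show "1 \<le> Re (csum a \<zeta> z)"
    using sums_le[OF _ half_Suc_sums Re_csum_sums[where a = a and \<zeta> = \<zeta>, OF assms]] by blast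
  have nn: "0 \<le> (1/2) ^ Suc i * Re (ckernel a (\<zeta> i) z)" for i
    using R[of i] by (intro mult_nonneg_nonneg) auto
  show "(1/2) ^ Suc i * Re (ckernel a (\<zeta> i) z) \<le> Re (csum a \<zeta> z)"
    using sum_le_suminf[of "\<lambda>i. (1/2) ^ Suc i * Re (ckernel a (\<zeta> i) z)" "{i}"] Re_csum_sums[where a = a and \<zeta> = \<zeta>, OF assms] nn
    by (simp add: sums_iff del: power_Suc)
qed

text \<open>Termwise differentiation on a convex neighbourhood \<open>hnorm a x < \<rho>\<close> of
  the point with \<open>\<rho> < 1\<close>. There
  \<open>|1 - hform a x (\<zeta> i)| >= 1 - \<rho>\<close>, so the derivatives are dominated by
  \<open>(1/2) ^ Suc i * L\<close> with \<open>L\<close> independent of \<open>i\<close>; complex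
  homogeneity passes to the limit.\<close>

lemma holo_on_csum:
  fixes a :: "'n::finite \<Rightarrow> real"
  assumes a: "\<forall>j. 0 < a j" and \<zeta>: "\<And>i. hnorm a (\<zeta> i) = 1"
  shows "holo_on (csum a \<zeta>) (ellipsoid a)"
  unfolding holo_on_def
proof
  fix z assume z: "z \<in> ellipsoid a"
  define \<rho> where "\<rho> = (1 + hnorm a z) / 2"
  have \<rho>: "hnorm a z < \<rho>" "\<rho> < 1" using z by (auto simp: \<rho>_def ellipsoid_eq)
  define S where "S = {z. hnorm a z < \<rho>}"
  have S: "convex S" "open S" "z \<in> S" "S \<subseteq> ellipsoid a"
    unfolding S_def using convex_hnorm_less[OF a] \<rho>
    by (auto simp: ellipsoid_eq intro!: open_Collect_less continuous_on_hnorm continuous_intros)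
  define f' where "f' i x v = (1/2) ^ Suc i * (2 * hform a v (\<zeta> i) / (1 - hform a x (\<zeta> i))\<^sup>2)" for i x v
  define L where "L = 2 * (\<Sum>j\<in>UNIV. 1 / a j) / (1 - \<rho>)\<^sup>2"
  have L0: "0 \<le> L" unfolding L_def using a \<rho> by (intro divide_nonneg_nonneg mult_nonneg_nonneg sum_nonneg) (auto simp: less_imp_le)
  have f'_le: "cmod (f' i x v) \<le> (1/2) ^ Suc i * (L * norm v)" if "x \<in> S" for i x v
  proof -
    have x: "hnorm a x < \<rho>" using that by (simp add: S_def)
    have le: "cmod (hform a v (\<zeta> i)) \<le> (\<Sum>j\<in>UNIV. 1 / a j) * norm v"
      using hform_le[of a v "\<zeta> i"] \<zeta>[of i] hnorm_le_norm[OF a, of v] by simp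
    moreover have "(1 - \<rho>)\<^sup>2 \<le> (cmod (1 - hform a x (\<zeta> i)))\<^sup>2"
      using norm_ckernel_le(2)[OF \<zeta> x \<rho>(2)] \<rho> by (intro power_mono) auto
    ultimately
    have "cmod (2 * hform a v (\<zeta> i) / (1 - hform a x (\<zeta> i))\<^sup>2) \<le> (2 * ((\<Sum>j\<in>UNIV. 1 / a j) * norm v)) / (1 - \<rho>)\<^sup>2"
      unfolding norm_divide norm_mult norm_power using \<rho> order_trans[OF norm_ge_zero le] by (intro frac_le mult_mono) auto
    then show ?thesis unfolding f'_def norm_mult norm_half_power
      by (intro mult_left_mono) (auto simp: L_def norm_divide norm_mult)
  qed
  have sf': "summable (\<lambda>i. f' (i + n) x v)" if "x \<in> S" for x v n
  proof (rule summable_comparison_test'[where N = 0])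
    show "summable (\<lambda>i. (1/2::real) ^ Suc (i + n) * (L * norm v))"
      by (intro summable_mult2 half_tail_suminf)
  qed (rule f'_le[OF that])
  define g' where "g' x v = (\<Sum>i. f' i x v)" for x v
  have tail: "cmod ((\<Sum>i<n. f' i x v) - g' x v) \<le> (1/2) ^ n * L * norm v" if x: "x \<in> S" for n x v
  proof -
    have sm: "summable (\<lambda>i. f' i x v)" using sf'[OF x, of 0] by simp
    have "(\<Sum>i<n. f' i x v) - g' x v = - (\<Sum>i. f' (i + n) x v)"
      unfolding g'_def by (subst suminf_split_initial_segment[OF sm, of n]) simp
    then have "cmod ((\<Sum>i<n. f' i x v) - g' x v) = cmod (\<Sum>i. f' (i + n) x v)" by simp
    also have "\<dots> \<le> (\<Sum>i. (1/2::real) ^ Suc (i + n) * (L * norm v))"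
      using f'_le[OF x] by (intro norm_suminf_le summable_mult2 half_tail_suminf)
    also have "\<dots> = (1/2) ^ n * L * norm v"
      by (subst suminf_mult2[symmetric]) (simp_all only: half_tail_suminf mult.assoc)
    finally show ?thesis .
  qed
  have "\<exists>g. \<forall>x\<in>S. (\<lambda>i. (1/2) ^ Suc i * ckernel a (\<zeta> i) x) sums (g x) \<and> (g has_derivative g' x) (at x within S)"
  proof (rule has_derivative_series[OF S(1) _ _ S(3)])
    show "((\<lambda>x. (1/2) ^ Suc i * ckernel a (\<zeta> i) x) has_derivative f' i x) (at x within S)" if "x \<in> S" for i x
    proof -
      have "(ckernel a (\<zeta> i) has_derivative (\<lambda>v. 2 * hform a v (\<zeta> i) / (1 - hform a x (\<zeta> i))\<^sup>2)) (at x within S)"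
        using that S(4) by (intro has_derivative_at_withinI[OF has_derivative_ckernel] \<zeta>) auto
      then show ?thesis unfolding f'_def by (rule has_derivative_mult_right)
    qed
    show "\<forall>\<^sub>F n in sequentially. \<forall>x\<in>S. \<forall>h. cmod ((\<Sum>i<n. f' i x h) - g' x h) \<le> e * norm h" if e: "e > 0" for e
    proof -
      have "(\<lambda>n. (1/2::real) ^ n * L) \<longlonglongrightarrow> 0 * L"
        by (intro tendsto_mult tendsto_const LIMSEQ_realpow_zero) auto
      then have "\<forall>\<^sub>F n in sequentially. (1/2) ^ n * L < e" using e by (intro order_tendstoD) auto
      then show ?thesis
      proof eventually_elim
        case (elim n)
        show ?case
        proof (intro ballI allI)
          fix x h assume "x \<in> S"
          then show "cmod ((\<Sum>i<n. f' i x h) - g' x h) \<le> e * norm h"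
            using tail[where x = x and n = n and v = h] elim mult_right_mono[of "(1/2) ^ n * L" e "norm h"] by simp
        qed
      qed
    qed
    show "(\<lambda>i. (1/2) ^ Suc i * ckernel a (\<zeta> i) z) sums csum a \<zeta> z" by (rule csum_sums[OF \<zeta> z])
  qed
  then obtain g where g: "\<And>x. x \<in> S \<Longrightarrow> (\<lambda>i. (1/2) ^ Suc i * ckernel a (\<zeta> i) x) sums (g x)"
    "\<And>x. x \<in> S \<Longrightarrow> (g has_derivative g' x) (at x within S)" by blast
  have eq: "g x = csum a \<zeta> x" if "x \<in> S" for x
    by (rule sums_unique2[OF g(1)[OF that] csum_sums[OF \<zeta>]]) (use S(4) that in auto)
  have "(g has_derivative g' z) (at z)" using g(2)[OF S(3)] unfolding at_within_open[OF S(3,2)] .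
  then have "(csum a \<zeta> has_derivative g' z) (at z)"
    by (rule has_derivative_transform_within_open[OF _ S(2,3)]) (rule eq)
  moreover have "g' z (c *s v) = c * g' z v" for c v
  proof -
    have "g' z (c *s v) = (\<Sum>i. c * f' i z v)"
      unfolding g'_def f'_def hform_smult_left by (simp add: mult_ac)
    also have "\<dots> = c * g' z v" unfolding g'_def using sf'[OF S(3), of 0] by (intro suminf_mult) simp
    finally show ?thesis .
  qed
  ultimately show "\<exists>L. (csum a \<zeta> has_derivative L) (at z) \<and> (\<forall>c v. L (c *s v) = c * L v)" by blast
qed

lemma finite_emeasure_ellipsoid:
  assumes "\<forall>j. 0 < a j"
  shows "emeasure lborel (ellipsoid a) < \<infinity>"
  using emeasure_bounded_finite[OF bounded_hnorm_less[OF assms, of 1]] by (simp add: ellipsoid_eq)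

section \<open>Integrability of the sum below the critical exponent, and its failure there\<close>

lemma csum_integrable_ge_1:
  fixes a :: "'n::finite \<Rightarrow> real" and r :: real
  assumes a: "\<forall>j. 0 < a j" and \<zeta>: "\<And>i. hnorm a (\<zeta> i) = 1" and r: "1 \<le> r" "r < real CARD('n) + 1"
  shows "Lpint r (ellipsoid a) (csum a \<zeta>) < \<infinity>"
proof -
  obtain M where M: "0 \<le> M" "\<And>\<zeta>. hnorm a \<zeta> = 1 \<Longrightarrow> Lpint r (ellipsoid a) (ckernel a \<zeta>) \<le> ennreal M"
    by (rule ckernel_integrable[OF a, of r]) (use r in auto)
  \<comment> \<open>A common bound for the norms of the kernels. As the weights sum to at most 1,
    Minkowski's inequality gives the same bound for the partial sums, and Fatou's lemma carries it
    to the limit.\<close>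
  define B where "B = M powr (1 / r)"
  have B: "0 \<le> B" "B powr r = M" using M(1) r by (auto simp: B_def powr_powr)
  have Kfin: "Lpint r (ellipsoid a) (ckernel a (\<zeta> i)) < \<infinity>" for i
    using M(2)[OF \<zeta>] by (rule le_less_trans) simp
  have K: "Lpnorm r (ellipsoid a) (ckernel a (\<zeta> i)) \<le> B" for i
    using r B M(2)[OF \<zeta>] by (intro Lpnorm_leI) auto
  define g where "g N z = (\<Sum>i<N. (1/2) ^ Suc i * ckernel a (\<zeta> i) z)" for N z
  have gc: "continuous_on (ellipsoid a) (g N)" for N
    unfolding g_def by (intro continuous_intros continuous_on_ckernel \<zeta>)
  have gn: "Lpint r (ellipsoid a) (g N) < \<infinity> \<and> Lpnorm r (ellipsoid a) (g N) \<le> (\<Sum>i<N. (1/2) ^ Suc i) * B" for N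
  proof (induction N)
    case 0
    then show ?case using r by (simp add: g_def Lpnorm_def)
  next
    case (Suc N)
    define k where "k z = (1/2) ^ Suc N * ckernel a (\<zeta> N) z" for z
    have kc: "continuous_on (ellipsoid a) k"
      unfolding k_def by (intro continuous_intros continuous_on_ckernel \<zeta>)
    have kf: "Lpint r (ellipsoid a) k < \<infinity>"
      unfolding k_def Lpint_cmult[OF open_ellipsoid continuous_on_ckernel[OF \<zeta>]]
      using Kfin[of N] by (simp add: ennreal_mult_less_top)
    have "Lpnorm r (ellipsoid a) k = (1/2) ^ Suc N * Lpnorm r (ellipsoid a) (ckernel a (\<zeta> N))"
      unfolding k_def using r by (subst Lpnorm_cmult[OF open_ellipsoid continuous_on_ckernel[OF \<zeta>]]) (auto simp: norm_half_power simp del: power_Suc)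
    also have "\<dots> \<le> (1/2) ^ Suc N * B" by (intro mult_left_mono K) auto
    finally have kn: "Lpnorm r (ellipsoid a) k \<le> (1/2) ^ Suc N * B" .
    have eq: "g (Suc N) = (\<lambda>z. g N z + k z)" by (auto simp: g_def k_def)
    have "Lpint r (ellipsoid a) (g (Suc N)) < \<infinity>"
      unfolding eq using Suc.IH kf by (intro Lpint_add_finite open_ellipsoid gc kc r) auto
    moreover have "Lpnorm r (ellipsoid a) (g (Suc N)) \<le> Lpnorm r (ellipsoid a) (g N) + Lpnorm r (ellipsoid a) k"
      unfolding eq using Suc.IH kf by (intro Lpnorm_triangle open_ellipsoid gc kc r) auto
    ultimately show ?case using Suc.IH kn by (simp add: distrib_right del: power_Suc)
  qed
  have le: "Lpint r (ellipsoid a) (g N) \<le> ennreal M" for N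
  proof -
    have "(\<Sum>i<N. (1/2::real) ^ Suc i) \<le> 1"
      using sum_le_suminf[of "\<lambda>i. (1/2::real) ^ Suc i" "{..<N}"] half_Suc_sums by (simp add: sums_iff del: power_Suc)
    then have "(\<Sum>i<N. (1/2::real) ^ Suc i) * B \<le> B" using mult_right_mono[OF _ B(1)] by fastforce
    then have "Lpnorm r (ellipsoid a) (g N) \<le> B" using gn[of N] by linarith
    then show ?thesis using gn[of N] r B by (subst (asm) Lpnorm_le_iff) auto
  qed
  have lim: "(\<lambda>N. indicator (ellipsoid a) z * ennreal (norm (g N z) powr r)) \<longlonglongrightarrow> indicator (ellipsoid a) z * ennreal (norm (csum a \<zeta> z) powr r)" for z
  proof (cases "z \<in> ellipsoid a")
    case True
    have "(\<lambda>N. g N z) \<longlonglongrightarrow> csum a \<zeta> z" using csum_sums[OF \<zeta> True] by (simp add: sums_def g_def)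
    moreover have "csum a \<zeta> z \<noteq> 0" using Re_csum_ge(1)[where a = a and \<zeta> = \<zeta>, OF \<zeta> True] by auto
    ultimately have "(\<lambda>N. norm (g N z) powr r) \<longlonglongrightarrow> norm (csum a \<zeta> z) powr r"
      by (intro tendsto_powr tendsto_norm tendsto_const) auto
    then show ?thesis using True by (simp add: tendsto_ennrealI)
  qed simp
  have "Lpint r (ellipsoid a) (csum a \<zeta>) = (\<integral>\<^sup>+ z. liminf (\<lambda>N. indicator (ellipsoid a) z * ennreal (norm (g N z) powr r)) \<partial>lborel)"
    by (intro nn_integral_cong lim_imp_Liminf[symmetric] lim) simp
  also have "\<dots> \<le> liminf (\<lambda>N. Lpint r (ellipsoid a) (g N))"
    by (intro nn_integral_liminf measurable_Lp_integrand open_ellipsoid gc)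
  also have "\<dots> \<le> liminf (\<lambda>N. ennreal M)"
    by (intro Liminf_mono always_eventually allI le)
  also have "\<dots> < \<infinity>" by (simp add: Liminf_const)
  finally show ?thesis .
qed

text \<open>Exponents below 1 do occur: for large \<open>q\<close> the product of
  \<open>(n + 1) / q\<close> with \<open>p_j\<close> can be less than 1. They are dominated by the
  exponent 1, which lies below \<open>n + 1\<close>.\<close>

lemma csum_integrable:
  fixes a :: "'n::finite \<Rightarrow> real" and r :: real
  assumes a: "\<forall>j. 0 < a j" and \<zeta>: "\<And>i. hnorm a (\<zeta> i) = 1" and r: "0 \<le> r" "r < real CARD('n) + 1"
  shows "Lpint r (ellipsoid a) (csum a \<zeta>) < \<infinity>"
proof -
  have "1 < real CARD('n) + 1" using zero_less_card_finite[where 'a='n] by simp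
  then have "Lpint (max 1 r) (ellipsoid a) (csum a \<zeta>) < \<infinity>"
    using r by (intro csum_integrable_ge_1 a \<zeta>) auto
  moreover have "Lpint r (ellipsoid a) (csum a \<zeta>) \<le> emeasure lborel (ellipsoid a) + Lpint (max 1 r) (ellipsoid a) (csum a \<zeta>)"
    using r by (intro Lpint_le_of_less_exponent open_ellipsoid holo_on_imp_continuous_on holo_on_csum a \<zeta>) auto
  ultimately show ?thesis using finite_emeasure_ellipsoid[OF a] by (auto intro: le_less_trans)
qed

text \<open>The modulus of the sum is at least the real part of its \<open>i\<close>-th term, which
  already has a divergent integral. The Euclidean ball contains the set
  \<open>hnorm a (z - \<zeta> i) < e / A\<close>, and \<open>w\<close> is the weight of that term
  raised to the critical power.\<close>

lemma csum_not_integrable: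
  fixes a :: "'n::finite \<Rightarrow> real"
  assumes a: "\<forall>j. 0 < a j" and \<zeta>: "\<And>i. hnorm a (\<zeta> i) = 1" and e: "0 < e"
  shows "Lpint (real CARD('n) + 1) (ball (\<zeta> i) e \<inter> ellipsoid a) (csum a \<zeta>) = \<infinity>"
proof -
  define A where "A = (\<Sum>j\<in>UNIV. a j)"
  have A: "A > 0" unfolding A_def using a by (intro sum_pos) auto
  define V where "V = {z \<in> ellipsoid a. hnorm a (z - \<zeta> i) < e / A}"
  have sub: "V \<subseteq> ball (\<zeta> i) e \<inter> ellipsoid a"
  proof
    fix z assume z: "z \<in> V"
    have "norm (z - \<zeta> i) \<le> A * hnorm a (z - \<zeta> i)" unfolding A_def by (rule norm_le_hnorm[OF a])
    also have "\<dots> < e" using z A by (simp add: V_def field_simps)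
    finally show "z \<in> ball (\<zeta> i) e \<inter> ellipsoid a" using z by (simp add: V_def dist_norm norm_minus_commute)
  qed
  define w where "w = ((1/2::real) ^ Suc i) ^ (CARD('n) + 1)"
  have w: "w > 0" by (simp add: w_def)
  define F where "F z = indicator V z * ennreal (Re (ckernel a (\<zeta> i) z) ^ (CARD('n) + 1))" for z
  have [measurable]: "ellipsoid a \<in> sets borel" using open_ellipsoid[of a] by auto
  have [measurable]: "V \<in> sets borel" unfolding V_def by measurable
  have [measurable]: "ckernel a (\<zeta> i) \<in> borel_measurable borel" unfolding ckernel_def by measurable
  have [measurable]: "F \<in> borel_measurable lborel" unfolding F_def by measurable
  have "(\<integral>\<^sup>+ z. F z \<partial>lborel) = \<infinity>"
    unfolding F_def V_def using e A by (intro Re_ckernel_not_integrable a \<zeta>) auto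
  then have "\<infinity> = (\<integral>\<^sup>+ z. ennreal w * F z \<partial>lborel)"
    using w by (subst nn_integral_cmult) (auto simp: ennreal_mult_top)
  also have "\<dots> \<le> Lpint (real CARD('n) + 1) (ball (\<zeta> i) e \<inter> ellipsoid a) (csum a \<zeta>)"
  proof (rule nn_integral_mono)
    fix z
    show "ennreal w * F z \<le> indicator (ball (\<zeta> i) e \<inter> ellipsoid a) z * ennreal (norm (csum a \<zeta> z) powr (real CARD('n) + 1))"
    proof (cases "z \<in> V")
      case True
      then have z: "z \<in> ellipsoid a" "z \<in> ball (\<zeta> i) e \<inter> ellipsoid a" using sub by auto
      have R: "1 \<le> Re (ckernel a (\<zeta> i) z)" using Re_ckernel_ge_1[OF \<zeta> z(1)] .
      have "(1/2) ^ Suc i * Re (ckernel a (\<zeta> i) z) \<le> norm (csum a \<zeta> z)"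
        using Re_csum_ge(2)[where a = a and \<zeta> = \<zeta>, OF \<zeta> z(1), of i] complex_Re_le_cmod[of "csum a \<zeta> z"] by linarith
      then have "((1/2) ^ Suc i * Re (ckernel a (\<zeta> i) z)) ^ (CARD('n) + 1) \<le> norm (csum a \<zeta> z) ^ (CARD('n) + 1)"
        using R by (intro power_mono mult_nonneg_nonneg) auto
      also have "\<dots> = norm (csum a \<zeta> z) powr (real CARD('n) + 1)"
      proof -
        have "csum a \<zeta> z \<noteq> 0" using Re_csum_ge(1)[where a = a and \<zeta> = \<zeta>, OF \<zeta> z(1)] by auto
        then show ?thesis using powr_realpow[of "norm (csum a \<zeta> z)" "CARD('n) + 1"] by (simp add: add.commute)
      qed
      finally have "w * Re (ckernel a (\<zeta> i) z) ^ (CARD('n) + 1) \<le> norm (csum a \<zeta> z) powr (real CARD('n) + 1)"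
        unfolding w_def power_mult_distrib .
      then show ?thesis using True z R w
        by (simp add: F_def ennreal_mult[symmetric] ennreal_leI less_imp_le del: power_Suc)
    qed (simp add: F_def)
  qed
  finally show ?thesis by (simp add: top_unique)
qed

subsection \<open>Functions without local integrability\<close>

text \<open>The left side is the modulus of the principal power of \<open>w\<close> with real
  exponent \<open>s\<close>; the argument of \<open>w\<close> affects only its phase.\<close>

lemma norm_exp_Ln: "w \<noteq> 0 \<Longrightarrow> cmod (exp (of_real s * Ln w)) = cmod w powr s"
  by (simp add: norm_exp_eq_Re powr_def)

text \<open>The real part is \<open>ln |w| = p * ln (|w|^(1/p)) <= p * |w|^(1/p)\<close>, and the
  imaginary part is at most \<open>pi < 4\<close>. The exponent \<open>1 / p\<close> makes the
  \<open>p\<close>-th power of the logarithm bounded by a multiple of \<open>|w|\<close>, which is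
  integrable for the sum of kernels.\<close>

lemma norm_Ln_le:
  assumes w: "1 \<le> cmod w" and p: "1 \<le> p"
  shows "cmod (Ln w) \<le> (p + 4) * cmod w powr (1 / p)"
proof -
  have w0: "w \<noteq> 0" using w by auto
  have x: "1 \<le> cmod w powr (1 / p)" using w p by (intro ge_one_powr_ge_zero) auto
  have "ln (cmod w) = p * ln (cmod w powr (1 / p))" using p w0 by (simp add: ln_powr)
  also have "\<dots> \<le> p * cmod w powr (1 / p)"
    using ln_bound[of "cmod w powr (1 / p)"] x p w0 by (intro mult_left_mono) auto
  finally have 1: "ln (cmod w) \<le> p * cmod w powr (1 / p)" .
  have "\<bar>Im (Ln w)\<bar> \<le> pi" using mpi_less_Im_Ln[OF w0] Im_Ln_le_pi[OF w0] by auto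
  then have "\<bar>Im (Ln w)\<bar> \<le> 4 * cmod w powr (1 / p)" using pi_less_4 x by linarith
  moreover have "cmod (Ln w) \<le> \<bar>Re (Ln w)\<bar> + \<bar>Im (Ln w)\<bar>" by (rule cmod_le)
  moreover have "\<bar>Re (Ln w)\<bar> = ln (cmod w)" using w w0 by simp
  ultimately show ?thesis using 1 by (simp add: algebra_simps)
qed

context
  fixes a :: "'n::finite \<Rightarrow> real" and \<zeta> :: "nat \<Rightarrow> complex ^ 'n"
  assumes a: "\<forall>j. 0 < a j" and \<zeta>: "\<And>i. hnorm a (\<zeta> i) = 1"
begin

lemma csum_props:
  assumes "z \<in> ellipsoid a"
  shows "csum a \<zeta> z \<notin> \<real>\<^sub>\<le>\<^sub>0" "csum a \<zeta> z \<noteq> 0" "1 \<le> cmod (csum a \<zeta> z)"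
  using Re_csum_ge(1)[where a = a and \<zeta> = \<zeta>, OF \<zeta> assms] complex_Re_le_cmod[of "csum a \<zeta> z"]
  by (auto simp: complex_nonpos_Reals_iff)

text \<open>For \<open>g = G^s\<close> one has \<open>|g|^p = |G|^(s * p)\<close>. The choice
  \<open>s = (n + 1) / q\<close> makes \<open>s * p\<close> critical exactly at
  \<open>p = q\<close>.\<close>

lemma extremal_function_finite_exponent:
  assumes sc: "OL_scale q ps (ellipsoid a)" and q: "q = ereal r"
  shows "\<exists>g\<in>OLbelow q (ellipsoid a). \<forall>i. \<forall>e>0. g \<notin> OL q (ball (\<zeta> i) e \<inter> ellipsoid a)"
proof -
  interpret OL_scale q ps "ellipsoid a" by (rule sc)
  \<comment> \<open>Here \<open>n\<close> is the critical exponent, one more than the complex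
    dimension.\<close>
  define n where "n = real CARD('n) + 1"
  have n: "n > 0" by (simp add: n_def add_nonneg_pos)
  have r: "ps j < r" for j using ps_less_q[of j] q by simp
  then have r0: "r > 1" using ps_gt_1[of 0] order.strict_trans by blast
  define s where "s = n / r"
  have s: "s > 0" using n r0 by (simp add: s_def)
  define f where "f z = exp (of_real s * Ln (csum a \<zeta> z))" for z
  \<comment> \<open>Extension by zero, the normalisation that \<open>OLbelow\<close>
    prescribes.\<close>
  define g where "g z = (if z \<in> ellipsoid a then f z else 0)" for z
  have ng: "cmod (g z) powr p = cmod (csum a \<zeta> z) powr (s * p)" if "z \<in> ellipsoid a" for z p
    using that csum_props(2)[OF that] norm_exp_Ln[of "csum a \<zeta> z" s] by (simp add: g_def f_def powr_powr)
  have Lg: "Lpint p U g = Lpint (s * p) U (csum a \<zeta>)" if "U \<subseteq> ellipsoid a" for p U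
    using that ng by (intro nn_integral_cong) (auto simp: indicator_def)
  have "holo_on f (ellipsoid a)"
    unfolding f_def
    by (rule holo_on_compose[OF holo_on_csum[OF a \<zeta>], of "\<lambda>w. exp (of_real s * Ln w)"])
       (auto simp: field_differentiable_def intro!: derivative_eq_intros csum_props(1) exI)
  then have hg: "holo_on g (ellipsoid a)"
    by (rule holo_on_cong_open[OF _ open_ellipsoid]) (simp add: g_def)
  have "Lpint (ps j) (ellipsoid a) g < \<infinity>" for j
  proof -
    have "s * ps j < n" using r[of j] n r0 by (simp add: s_def field_simps)
    then show ?thesis unfolding Lg[OF order_refl]
      using s ps_gt_1[of j] by (intro csum_integrable a \<zeta>) (auto simp: n_def)
  qed
  then have "g \<in> OLbelow q (ellipsoid a)" using hg by (auto simp: OLbelow_iff g_def)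
  moreover have "g \<notin> OL q (ball (\<zeta> i) e \<inter> ellipsoid a)" if "e > 0" for i e
  proof -
    have "s * r = n" using r0 by (simp add: s_def)
    then have "Lpint r (ball (\<zeta> i) e \<inter> ellipsoid a) g = \<infinity>"
      using csum_not_integrable[where a = a and \<zeta> = \<zeta> and i = i, OF a \<zeta> that] Lg[of "ball (\<zeta> i) e \<inter> ellipsoid a" r] by (simp add: n_def)
    then show ?thesis using q by (simp add: OL_def)
  qed
  ultimately show ?thesis by blast
qed

text \<open>The logarithm of the sum lies in every \<open>L^p\<close> by \<open>norm_Ln_le\<close>.
  If it were bounded near some \<open>\<zeta> i\<close>, its real part \<open>ln |G|\<close> would
  bound \<open>|G|\<close> there, and a bounded function on a set of finite measure has integrable
  powers, contrary to the divergence at the critical exponent.\<close>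

lemma extremal_function_infinite_exponent:
  assumes sc: "OL_scale q ps (ellipsoid a)" and q: "q = \<infinity>"
  shows "\<exists>g\<in>OLbelow q (ellipsoid a). \<forall>i. \<forall>e>0. g \<notin> OL q (ball (\<zeta> i) e \<inter> ellipsoid a)"
proof -
  interpret OL_scale q ps "ellipsoid a" by (rule sc)
  define g where "g z = (if z \<in> ellipsoid a then Ln (csum a \<zeta> z) else 0)" for z
  have cc: "continuous_on (ellipsoid a) (csum a \<zeta>)"
    by (intro holo_on_imp_continuous_on holo_on_csum a \<zeta>)
  have "holo_on (\<lambda>z. Ln (csum a \<zeta> z)) (ellipsoid a)"
    by (rule holo_on_compose[OF holo_on_csum[OF a \<zeta>]]) (intro field_differentiable_at_Ln csum_props)
  then have hg: "holo_on g (ellipsoid a)"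
    by (rule holo_on_cong_open[OF _ open_ellipsoid]) (simp add: g_def)
  have "Lpint (ps j) (ellipsoid a) g < \<infinity>" for j
  proof -
    note [measurable] = measurable_Lp_integrand[OF open_ellipsoid cc, of 1]
    have p: "1 \<le> ps j" using ps_gt_1[of j] by simp
    have le: "cmod (g z) powr ps j \<le> (ps j + 4) powr ps j * cmod (csum a \<zeta> z) powr 1" if z: "z \<in> ellipsoid a" for z
    proof -
      have "cmod (g z) powr ps j \<le> ((ps j + 4) * cmod (csum a \<zeta> z) powr (1 / ps j)) powr ps j"
        using norm_Ln_le[OF csum_props(3)[OF z] p] p z by (intro powr_mono2) (auto simp: g_def)
      then show ?thesis using p by (simp add: powr_mult powr_powr)
    qed
    have "Lpint (ps j) (ellipsoid a) g \<le> (\<integral>\<^sup>+ z. ennreal ((ps j + 4) powr ps j) * (indicator (ellipsoid a) z * ennreal (cmod (csum a \<zeta> z) powr 1)) \<partial>lborel)"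
      using le by (intro nn_integral_mono) (auto simp: indicator_def ennreal_mult[symmetric] simp del: powr_one intro!: ennreal_leI)
    also have "\<dots> = ennreal ((ps j + 4) powr ps j) * Lpint 1 (ellipsoid a) (csum a \<zeta>)"
      by (intro nn_integral_cmult) measurable
    also have "\<dots> < \<infinity>"
      using csum_integrable[where a = a and \<zeta> = \<zeta> and r = 1, OF a \<zeta>] zero_less_card_finite[where 'a='n]
      by (auto simp: ennreal_mult_less_top)
    finally show ?thesis .
  qed
  then have "g \<in> OLbelow q (ellipsoid a)" using hg by (auto simp: OLbelow_iff g_def)
  moreover have "g \<notin> OL q (ball (\<zeta> i) e \<inter> ellipsoid a)" if e: "e > 0" for i e
  proof
    let ?U = "ball (\<zeta> i) e \<inter> ellipsoid a"
    define n where "n = real CARD('n) + 1"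
    have n: "n > 0" by (simp add: n_def add_nonneg_pos)
    assume "g \<in> OL q ?U"
    then have "bounded (g ` ?U)" using q by (simp add: OL_def)
    then obtain M where M: "\<And>z. z \<in> ?U \<Longrightarrow> cmod (g z) \<le> M" unfolding bounded_iff by blast
    have le: "cmod (csum a \<zeta> z) powr n \<le> exp M powr n" if z: "z \<in> ?U" for z
    proof -
      have "ln (cmod (csum a \<zeta> z)) = Re (g z)" using z csum_props(2)[of z] by (simp add: g_def)
      also have "\<dots> \<le> M" using M[OF z] complex_Re_le_cmod[of "g z"] by linarith
      finally have "cmod (csum a \<zeta> z) \<le> exp M" 
        using z csum_props(2)[of z] exp_le_cancel_iff[of "ln (cmod (csum a \<zeta> z))" M] by simp
      then show ?thesis using n by (intro powr_mono2) auto
    qed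
    have oU: "?U \<in> sets borel" using open_D by auto
    have fU: "emeasure lborel ?U < \<infinity>"
      using emeasure_mono[of ?U "ellipsoid a" lborel] finite_D open_D by (auto intro: le_less_trans)
    have "Lpint n ?U (csum a \<zeta>) \<le> (\<integral>\<^sup>+ z. ennreal (exp M powr n) * indicator ?U z \<partial>lborel)"
      using le by (intro nn_integral_mono) (auto simp: indicator_def intro!: ennreal_leI)
    also have "\<dots> = ennreal (exp M powr n) * emeasure lborel ?U"
      using oU by (subst nn_integral_cmult) auto
    also have "\<dots> < \<infinity>" using fU by (simp add: ennreal_mult_less_top)
    finally show False using csum_not_integrable[where a = a and \<zeta> = \<zeta> and i = i, OF a \<zeta> e] by (simp add: n_def)
  qed
  ultimately show ?thesis by blast
qed

end

section \<open>Total unboundedness and the theorem\<close>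

lemma bounded_imp_OL:
  assumes f: "holo_on f U" and U: "open U" "emeasure lborel U < \<infinity>" and q: "0 < q"
    and b: "bounded (f ` U)"
  shows "f \<in> OL q U"
proof (cases "q = \<infinity>")
  case True then show ?thesis using f b by (simp add: OL_def)
next
  case False
  define p where "p = real_of_ereal q"
  have p: "p > 0" using q False unfolding p_def by (cases q) auto
  obtain M where M: "\<And>z. z \<in> U \<Longrightarrow> cmod (f z) \<le> M" using b by (auto simp: bounded_iff)
  have "Lpint p U f \<le> (\<integral>\<^sup>+ z. ennreal (M powr p) * indicator U z \<partial>lborel)"
    using M p by (intro nn_integral_mono) (auto simp: indicator_def intro!: ennreal_leI powr_mono2)
  also have "\<dots> = ennreal (M powr p) * emeasure lborel U"
    using U by (subst nn_integral_cmult) auto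
  also have "\<dots> < \<infinity>" using U by (simp add: ennreal_mult_less_top)
  finally show ?thesis using f False by (simp add: OL_def p_def)
qed

lemma totally_unbounded_if_not_OL:
  assumes D: "convex D" "open D" "emeasure lborel D < \<infinity>" and g: "holo_on g D" and q: "0 < q"
    and n: "\<And>w e. w \<in> frontier D \<Longrightarrow> 0 < e \<Longrightarrow> g \<notin> OL q (ball w e \<inter> D)"
  shows "totally_unbounded g D"
  unfolding totally_unbounded_def
proof (intro ballI allI impI)
  fix w \<delta> E assume w: "w \<in> frontier D" and \<delta>: "(0::real) < \<delta>" and E: "E \<in> components (ball w \<delta> \<inter> D)"
  have "connected (ball w \<delta> \<inter> D)" using D by (intro convex_connected convex_Int) auto
  moreover have "ball w \<delta> \<inter> D \<noteq> {}" using E by force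
  ultimately have "E = ball w \<delta> \<inter> D" using E components_eq_sing_iff[of "ball w \<delta> \<inter> D"] by simp
  show "(SUP z\<in>E. ereal (norm (g z))) = \<infinity>"
  proof (rule ccontr)
    assume *: "(SUP z\<in>E. ereal (norm (g z))) \<noteq> \<infinity>"
    then obtain M where "(SUP z\<in>E. ereal (norm (g z))) \<le> ereal M"
      by (cases "SUP z\<in>E. ereal (norm (g z))") auto
    then have "norm (g z) \<le> M" if "z \<in> E" for z using that by (simp add: SUP_le_iff)
    then have "bounded (g ` E)" by (auto simp: bounded_iff)
    moreover have "emeasure lborel E < \<infinity>"
      using emeasure_mono[of E D lborel] D \<open>E = _\<close> by (auto intro: le_less_trans)
    ultimately have "g \<in> OL q E"
      using D g q \<open>E = _\<close> holo_on_subset[of g D E] by (intro bounded_imp_OL) auto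
    then show False using n[OF w \<delta>] \<open>E = _\<close> by simp
  qed
qed

theorem theorem12:
  fixes q :: ereal and a :: "'n::finite \<Rightarrow> real" and ps :: "nat \<Rightarrow> real"
  assumes "1 < q"
    and "\<forall>j. 0 < a j"
    and "1 < ps 0" and "strict_mono ps" and "(\<lambda>j. ereal (ps j)) \<longlonglongrightarrow> q"
  defines "\<Omega> \<equiv> ellipsoid a"
  defines "X \<equiv> OLbelow q \<Omega>"
  defines "S \<equiv> {g \<in> X. totally_unbounded g \<Omega> \<and>
                 (\<forall>\<zeta>\<in>frontier \<Omega>. \<forall>\<epsilon>>0. g \<notin> OL q (ball \<zeta> \<epsilon> \<inter> \<Omega>))}"
  shows "(Metric_space.mtopology X (OLdist ps \<Omega>)) closure_of S = X
       \<and> gdelta_in (Metric_space.mtopology X (OLdist ps \<Omega>)) S"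
proof -
  note a = \<open>\<forall>j. 0 < a j\<close>
  interpret OL_scale q ps \<Omega>
    unfolding \<Omega>_def using assms(3-5) open_ellipsoid finite_emeasure_ellipsoid[OF a] by unfold_locales
  \<comment> \<open>Only a nonempty set can be the range of a sequence, and the dense set
    \<open>T\<close> is to be enumerated.\<close>
  have "frontier \<Omega> \<noteq> {}"
  proof -
    have "0 \<in> \<Omega>" by (simp add: \<Omega>_def ellipsoid_def)
    moreover have "bounded \<Omega>" using bounded_hnorm_less[OF a] by (simp add: \<Omega>_def ellipsoid_eq)
    ultimately show ?thesis using frontier_eq_empty[of \<Omega>] not_bounded_UNIV by auto
  qed
  obtain T where T: "countable T" "T \<subseteq> frontier \<Omega>" "frontier \<Omega> \<subseteq> closure T"
    using separable[of "frontier \<Omega>"] by blast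
  then have "T \<noteq> {}" using \<open>frontier \<Omega> \<noteq> {}\<close> by auto
  define \<zeta> where "\<zeta> = from_nat_into T"
  have r\<zeta>: "range \<zeta> = T" unfolding \<zeta>_def using T(1) \<open>T \<noteq> {}\<close> by (rule range_from_nat_into[rotated])
  have \<zeta>f: "\<zeta> i \<in> frontier \<Omega>" for i using r\<zeta> T(2) by blast
  then have \<zeta>1: "hnorm a (\<zeta> i) = 1" for i using frontier_ellipsoid_subset[of a] unfolding \<Omega>_def by blast
  have "\<exists>g\<in>X. \<forall>i. \<forall>e>0. g \<notin> OL q (ball (\<zeta> i) e \<inter> \<Omega>)"
  proof (cases "q = \<infinity>")
    case True
    show ?thesis unfolding X_def \<Omega>_def
      by (rule extremal_function_infinite_exponent[where \<zeta> = \<zeta>, OF a \<zeta>1 OL_scale_axioms[unfolded \<Omega>_def] True])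
  next
    case False
    then obtain r where r: "q = ereal r" using \<open>1 < q\<close> by (cases q) auto
    show ?thesis unfolding X_def \<Omega>_def
      by (rule extremal_function_finite_exponent[where \<zeta> = \<zeta>, OF a \<zeta>1 OL_scale_axioms[unfolded \<Omega>_def] r])
  qed
  then obtain g where g: "g \<in> X" "\<And>i e. 0 < e \<Longrightarrow> g \<notin> OL q (ball (\<zeta> i) e \<inter> \<Omega>)" by blast
  \<comment> \<open>These sets decide all boundary points: every \<open>ball w e\<close> around a
    frontier point contains a ball with centre some \<open>\<zeta> i\<close> and radius
    \<open>1 / (m + 1)\<close>, and membership in \<open>OL q\<close> passes to smaller
    sets.\<close>
  define \<U> where "\<U> = range (\<lambda>(i, m::nat). ball (\<zeta> i) (1 / (m + 1)) \<inter> \<Omega>)"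
  have \<U>: "countable \<U>" "\<And>U. U \<in> \<U> \<Longrightarrow> open U \<and> U \<subseteq> \<Omega>"
    unfolding \<U>_def using open_D by auto
  have "S = {g \<in> X. \<forall>U\<in>\<U>. g \<notin> OL q U}"
  proof (intro equalityI subsetI)
    fix f assume "f \<in> S"
    then show "f \<in> {g \<in> X. \<forall>U\<in>\<U>. g \<notin> OL q U}"
      using \<zeta>f by (auto simp: S_def \<U>_def)
  next
    fix f assume f: "f \<in> {g \<in> X. \<forall>U\<in>\<U>. g \<notin> OL q U}"
    have n: "f \<notin> OL q (ball w e \<inter> \<Omega>)" if w: "w \<in> frontier \<Omega>" and e: "0 < e" for w e
    proof
      assume *: "f \<in> OL q (ball w e \<inter> \<Omega>)"
      have "w \<in> closure T" using w T(3) by blast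
      then obtain x where x: "x \<in> T" "dist x w < e / 2" using e by (auto simp: closure_approachable dest!: spec[of _ "e/2"])
      obtain i where i: "x = \<zeta> i" using x r\<zeta> by blast
      obtain m :: nat where "1 / real (Suc m) < e / 2"
        by (rule nat_approx_posE[of "e / 2"]) (use e in auto)
      then have m: "1 / (m + 1) < e / 2" by (simp add: add.commute)
      have "ball (\<zeta> i) (1 / (m + 1)) \<subseteq> ball w e"
      proof
        fix y assume "y \<in> ball (\<zeta> i) (1 / (m + 1))"
        then have "dist (\<zeta> i) y < e / 2" using m by simp
        then show "y \<in> ball w e" using x i dist_triangle[of w y "\<zeta> i"] by (simp add: dist_commute)
      qed
      then have "f \<in> OL q (ball (\<zeta> i) (1 / (m + 1)) \<inter> \<Omega>)" using OL_subset[OF *] by blast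
      moreover have "ball (\<zeta> i) (1 / (m + 1)) \<inter> \<Omega> \<in> \<U>" unfolding \<U>_def by (rule image_eqI[of _ _ "(i, m)"]) (auto simp: add.commute)
      ultimately show False using f by blast
    qed
    have "convex \<Omega>" using convex_hnorm_less[OF a] by (simp add: \<Omega>_def ellipsoid_eq)
    moreover have "holo_on f \<Omega>" using f OLbelow_iff X_def by blast
    moreover have "0 < q" using \<open>1 < q\<close> by (rule order.strict_trans[rotated]) simp
    ultimately have "totally_unbounded f \<Omega>"
      using open_D finite_D n by (intro totally_unbounded_if_not_OL) auto
    then show "f \<in> S" using f n by (simp add: S_def)
  qed
  moreover have "g \<notin> OL q U" if "U \<in> \<U>" for U
    using that g(2) by (auto simp: \<U>_def)
  ultimately show ?thesis
    using dense_not_OL[OF \<U>, of g] gdelta_not_OL[OF \<U>] g(1) unfolding X_def by simp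
qed

end
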